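(* Let $\alpha\ge1/2$, and let $X_1,X_2,\ldots$ be a sequence of non-negative i.i.d. random variables with finite mean $\mu$. Let $\gamma\in(0,1)$ denote the level of significance of the test and let $c_{n,\gamma}$ be the $(1-\gamma)$-quantile of the test statistic $T_n^2$ under the null hypothesis $H_0$ that $X_1,X_2,\ldots$ are i.i.d. with distribution in $\{Gamma(\alpha,\lambda):\lambda>0\}$. If the distribution of $X_1$ does not belong to $\{Gamma(\alpha,\lambda):\lambda>0\}$, then $$\lim_{n\to\infty}P\big(T_n^2>c_{n,\gamma}\big)=1.$$
   Context: $Gamma(\alpha,\lambda)$ denotes the distribution with density $\lambda^\alpha x^{\alpha-1}e^{-\lambda x}/\Gamma(\alpha)$, $x>0$; $P_0=Gamma(\alpha,1)$. With $\overline{X}_n=n^{-1}\sum_{j=1}^nX_j$, let $Y_j=X_j/\overline{X}_n$ if $\overline{X}_n\ne0$ and $Y_j=0$ if $\overline{X}_n=0$, $j=1,\ldots,n$, and $$T_n^2=n\int_0^\infty\Big[\frac1n\sum_{j=1}^n\Gamma(\alpha)(tY_j)^{(1-\alpha)/2}J_{\alpha-1}\big(2\sqrt{tY_j}\big)-e^{-t/\alpha}\Big]^2\,dP_0(t),$$ where $J_\nu(z)=\sum_{j\ge0}\frac{(-1)^j}{j!\,\Gamma(\nu+1+j)}(z/2)^{2j+\nu}$ and $x^{(1-\alpha)/2}J_{\alpha-1}(2\sqrt x)$ is taken to be $1/\Gamma(\alpha)$ at $x=0$. The distribution of $T_n^2$ under $H_0$ does not depend on $\lambda$, and $c_{n,\gamma}=\inf\{x\ge0:P_{H_0}(T_n^2>x)\le\gamma\}$.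 *)

theory Defs
  imports "HOL-Probability.Probability"
begin

definition gamma_density :: "real \<Rightarrow> real \<Rightarrow> real \<Rightarrow> real" where
  "gamma_density \<alpha> \<beta> x =
     (if x > 0 then \<beta> powr \<alpha> * x powr (\<alpha> - 1) * exp (- \<beta> * x) / Gamma \<alpha> else 0)"

definition gamma_dist :: "real \<Rightarrow> real \<Rightarrow> real measure" where
  "gamma_dist \<alpha> \<beta> = density lborel (\<lambda>x. ennreal (gamma_density \<alpha> \<beta> x))"

text \<open>Intended for \<open>z > 0\<close>: the real power \<open>powr\<close> vanishes at \<open>z = 0\<close> for every exponent.\<close>

definition bessel_J :: "real \<Rightarrow> real \<Rightarrow> real" where
  "bessel_J \<nu> z =
     (\<Sum>j. (-1) ^ j / (fact j * Gamma (\<nu> + 1 + real j)) * (z / 2) powr (2 * real j + \<nu>))"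

text \<open>The function \<open>x powr ((1 - \<alpha>) / 2) * bessel_J (\<alpha> - 1) (2 * sqrt x)\<close>, continuously
  extended to \<open>x = 0\<close>.\<close>

definition hankel_kernel :: "real \<Rightarrow> real \<Rightarrow> real" where
  "hankel_kernel \<alpha> x =
     (if x = 0 then 1 / Gamma \<alpha> else x powr ((1 - \<alpha>) / 2) * bessel_J (\<alpha> - 1) (2 * sqrt x))"

text \<open>A sample of size \<open>n\<close> is given by the values \<open>x 0, \<dots>, x (n - 1)\<close>.\<close>

definition sample_mean :: "nat \<Rightarrow> (nat \<Rightarrow> real) \<Rightarrow> real" where
  "sample_mean n x = (\<Sum>j<n. x j) / real n"

definition scaled_obs :: "nat \<Rightarrow> (nat \<Rightarrow> real) \<Rightarrow> nat \<Rightarrow> real" where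
  "scaled_obs n x j = (if sample_mean n x \<noteq> 0 then x j / sample_mean n x else 0)"

definition T2 :: "real \<Rightarrow> nat \<Rightarrow> (nat \<Rightarrow> real) \<Rightarrow> real" where
  "T2 \<alpha> n x = real n *
     (LINT t:{0<..}|gamma_dist \<alpha> 1.
        ((\<Sum>j<n. Gamma \<alpha> * hankel_kernel \<alpha> (t * scaled_obs n x j)) / real n
          - exp (- t / \<alpha>))\<^sup>2)"

text \<open>The null probability is computed for a sample from \<open>gamma_dist \<alpha> \<beta>\<close>. Its value does not
  depend on the rate \<open>\<beta> > 0\<close>, since \<open>T2\<close> is scale invariant; keeping \<open>\<beta>\<close> as a parameter avoids building
  this fact into the definition.\<close>

definition critical_value :: "real \<Rightarrow> real \<Rightarrow> nat \<Rightarrow> real \<Rightarrow> real" where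
  "critical_value \<alpha> \<beta> n \<gamma> =
     Inf {q. 0 \<le> q \<and>
       measure (\<Pi>\<^sub>M j\<in>{..<n}. gamma_dist \<alpha> \<beta>)
         {x \<in> space (\<Pi>\<^sub>M j\<in>{..<n}. gamma_dist \<alpha> \<beta>). T2 \<alpha> n x > q} \<le> \<gamma>}"

end

theory Submission
  imports Defs
begin

text \<open>The statistic compares two Hankel transforms. Write \<open>h\<close> for the kernel
  \<open>\<Gamma>(\<alpha>) * x powr ((1 - \<alpha>) / 2) * J(2 * sqrt x)\<close> with the Bessel function \<open>J\<close> of order \<open>\<alpha> - 1\<close>,
  write \<open>\<mu>\<close> for the mean of the observations, and let \<open>\<phi> t\<close> be the expectation of
  \<open>h (t * X / \<mu>)\<close>. The idea is that \<open>T2 / n\<close> converges in probability to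
  \<open>\<Delta> = \<integral> (\<phi> t - exp (- t / \<alpha>))\<^sup>2\<close>, integrated over the law \<open>gamma_dist \<alpha> 1\<close>, for every law of the
  observations on the nonnegative half-line with finite mean, and that \<open>\<Delta>\<close> vanishes exactly for the Gamma laws of shape \<open>\<alpha>\<close>.
  Under the null hypothesis \<open>T2 / n\<close> therefore tends to zero, so the critical value is eventually
  at most \<open>n * \<epsilon>\<close> for every \<open>\<epsilon> > 0\<close>; under an alternative \<open>T2\<close> exceeds \<open>n * \<Delta> / 2\<close> with probability
  tending to one. Taking \<open>\<epsilon> = \<Delta> / 2\<close> proves the theorem.

  Convergence (\<open>T2_converges_in_probability\<close>) is obtained in mean. The kernel is bounded by \<open>1\<close>
  for \<open>\<alpha> \<ge> 1 / 2\<close> (\<open>norm_bessel_abs_le_1\<close>, an energy estimate for the Bessel equation) and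
  Lipschitz, since its derivative is a kernel with shifted parameter. Boundedness controls the
  empirical average for each fixed \<open>t\<close> by its variance, and the Lipschitz property reduces the effect
  of dividing by the sample mean instead of \<open>\<mu>\<close> to the law of large numbers for the mean, which
  follows by truncation.

  Positivity of \<open>\<Delta>\<close> off the Gamma family (\<open>discrepancy_eq_0_imp_gamma\<close>) rests on the identity
  \<open>\<integral> h (t * x) = exp (- x / s)\<close>, integrated in \<open>t\<close> over \<open>gamma_dist \<alpha> s\<close>
  (\<open>gamma_dist_integral_norm_bessel\<close>). By it, for \<open>\<mu> > 0\<close>, averaging \<open>\<phi>\<close> over \<open>gamma_dist \<alpha> s\<close> gives the
  Laplace transform of \<open>X / \<mu>\<close> at \<open>1 / s\<close>, so \<open>\<phi>\<close> determines the law
  by uniqueness of Laplace transforms (\<open>laplace_uniqueness_nat\<close>); the same identity, with the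
  roles of \<open>x\<close> and \<open>t\<close> exchanged, shows that \<open>\<phi> t = exp (- t / \<alpha>)\<close> for the Gamma laws.\<close>

section \<open>The normalised Bessel kernel\<close>

definition norm_bessel_coeff :: "real \<Rightarrow> nat \<Rightarrow> real" where
  "norm_bessel_coeff a j = (-1) ^ j / (fact j * pochhammer a j)"

text \<open>The confluent hypergeometric limit function, \<open>norm_bessel a x = \<^sub>0F\<^sub>1(; a; - x)\<close>.
  It is the kernel of the test statistic, normalised to have the value \<open>1\<close> at \<open>0\<close>; unlike the
  expression through Bessel functions it is visibly entire in \<open>x\<close>.\<close>

definition norm_bessel :: "real \<Rightarrow> real \<Rightarrow> real" where
  "norm_bessel a x = (\<Sum>j. norm_bessel_coeff a j * x ^ j)"

lemma norm_bessel_coeff_Suc: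
  "norm_bessel_coeff a (Suc j) = - norm_bessel_coeff a j / ((real j + 1) * (a + real j))"
  by (simp add: norm_bessel_coeff_def pochhammer_Suc algebra_simps)

lemma summable_norm_bessel:
  assumes a: "a > 0"
  shows "summable (\<lambda>j. norm_bessel_coeff a j * x ^ j)"
proof (rule summable_ratio_test[where c = "1/2" and N = "nat \<lceil>2 * \<bar>x\<bar>\<rceil> + 1"])
  fix j assume "j \<ge> nat \<lceil>2 * \<bar>x\<bar>\<rceil> + 1"
  then have j: "real j \<ge> 2 * \<bar>x\<bar>" "real j \<ge> 1" by linarith+
  have "2 * \<bar>x\<bar> * 1 \<le> (a + real j) * (real j + 1)"
    using j a by (intro mult_mono) auto
  moreover have "(real j + 1) * (a + real j) > 0"
    using a by simp
  ultimately have "\<bar>x\<bar> / ((real j + 1) * (a + real j)) \<le> 1 / 2"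
    by (subst pos_divide_le_eq) (auto simp: mult_ac)
  then have "\<bar>norm_bessel_coeff a j * x ^ j\<bar> * (\<bar>x\<bar> / ((real j + 1) * (a + real j)))
      \<le> \<bar>norm_bessel_coeff a j * x ^ j\<bar> * (1 / 2)"
    by (intro mult_left_mono) auto
  then show "norm (norm_bessel_coeff a (Suc j) * x ^ Suc j) \<le> 1 / 2 * norm (norm_bessel_coeff a j * x ^ j)"
    using a by (simp add: norm_bessel_coeff_Suc abs_mult mult_ac)
qed simp

lemma diffs_norm_bessel_coeff:
  assumes a: "a > 0"
  shows "diffs (norm_bessel_coeff a) j = - (1 / a) * norm_bessel_coeff (a + 1) j"
proof -
  have "pochhammer a (Suc j) = a * pochhammer (a + 1) j"
    by (rule pochhammer_rec)
  moreover have "pochhammer (a + 1) j > 0"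
    using a by (intro pochhammer_pos) simp
  ultimately show ?thesis
    using a by (simp add: diffs_def norm_bessel_coeff_def divide_simps)
qed

lemma DERIV_norm_bessel:
  assumes a: "a > 0"
  shows "(norm_bessel a has_real_derivative - (1 / a) * norm_bessel (a + 1) x) (at x)"
proof -
  have "(norm_bessel a has_real_derivative (\<Sum>j. diffs (norm_bessel_coeff a) j * x ^ j)) (at x)"
    using termdiffs_strong_converges_everywhere[OF summable_norm_bessel[OF a]]
    unfolding norm_bessel_def[abs_def] .
  also have "(\<Sum>j. diffs (norm_bessel_coeff a) j * x ^ j)
      = (\<Sum>j. - (1 / a) * (norm_bessel_coeff (a + 1) j * x ^ j))"
    unfolding diffs_norm_bessel_coeff[OF a] by (simp add: mult_ac)
  also have "\<dots> = - (1 / a) * norm_bessel (a + 1) x"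
    unfolding norm_bessel_def using summable_norm_bessel[of "a + 1" x] a by (subst suminf_mult) auto
  finally show ?thesis .
qed

lemma norm_bessel_0 [simp]: "norm_bessel a 0 = 1"
  unfolding norm_bessel_def
  by (subst suminf_finite[of "{0}"]) (auto simp: norm_bessel_coeff_def)

lemma isCont_norm_bessel: "a > 0 \<Longrightarrow> isCont (norm_bessel a) x"
  using DERIV_norm_bessel DERIV_isCont by blast

lemma borel_measurable_norm_bessel: "a > 0 \<Longrightarrow> norm_bessel a \<in> borel_measurable borel"
  by (intro borel_measurable_continuous_onI continuous_at_imp_continuous_on ballI isCont_norm_bessel)

text \<open>Because differentiation shifts the parameter, this three-term relation is the Bessel differential
  equation \<open>x * h'' + a * h' + h = 0\<close> for \<open>h = norm_bessel a\<close> in disguise. It is proved by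
  comparing coefficients.\<close>

lemma norm_bessel_recurrence:
  assumes a: "a > 0"
  shows "norm_bessel a x - norm_bessel (a + 1) x + x / (a * (a + 1)) * norm_bessel (a + 2) x = 0"
proof -
  let ?c = norm_bessel_coeff
  have s: "summable (\<lambda>j. ?c b j * x ^ j)" if "b > 0" for b
    by (rule summable_norm_bessel[OF that])
  have coeff: "?c a (Suc j) - ?c (a + 1) (Suc j) = - (1 / (a * (a + 1))) * ?c (a + 2) j" for j
  proof -
    have p: "pochhammer a (Suc j) = a * pochhammer (a + 1) j"
      "pochhammer (a + 1) (Suc j) = (a + 1) * pochhammer (a + 2) j"
      "pochhammer (a + 1) (Suc j) = pochhammer (a + 1) j * (a + 1 + real j)"
      using pochhammer_rec[of a j] pochhammer_rec[of "a + 1" j] pochhammer_rec'[of "a + 1" j]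
      by (simp_all add: add_ac mult.commute)
    have q: "pochhammer (a + 1) j > 0" "pochhammer (a + 2) j > 0"
      using a by (auto intro!: pochhammer_pos)
    have e: "pochhammer (a + 2) j = pochhammer (a + 1) j * (a + 1 + real j) / (a + 1)"
      using p(2,3) a by (simp add: field_simps)
    show ?thesis
      unfolding norm_bessel_coeff_def p(1) p(3) e
      using a q by (simp add: divide_simps) (simp add: algebra_simps)
  qed
  have "norm_bessel a x - norm_bessel (a + 1) x = (\<Sum>j. (?c a j - ?c (a + 1) j) * x ^ j)"
    unfolding norm_bessel_def using s[of a] s[of "a + 1"] a
    by (subst suminf_diff) (auto simp: algebra_simps)
  also have "\<dots> = (\<Sum>j. (?c a (Suc j) - ?c (a + 1) (Suc j)) * x ^ Suc j)"
  proof -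
    have "summable (\<lambda>j. (?c a j - ?c (a + 1) j) * x ^ j)"
      using summable_diff[OF s[of a] s[of "a + 1"]] a by (simp add: algebra_simps)
    from suminf_split_head[OF this] show ?thesis
      by (simp add: norm_bessel_coeff_def)
  qed
  also have "\<dots> = (\<Sum>j. - (x / (a * (a + 1))) * (?c (a + 2) j * x ^ j))"
    unfolding coeff by (simp add: mult_ac)
  also have "\<dots> = - (x / (a * (a + 1))) * norm_bessel (a + 2) x"
    unfolding norm_bessel_def using s[of "a + 2"] a by (subst suminf_mult) auto
  finally show ?thesis by simp
qed

text \<open>An energy argument: for \<open>h = norm_bessel a\<close>, the differential equation turns the derivative of
  \<open>E x = (h x)\<^sup>2 + x * (h' x)\<^sup>2\<close> into \<open>(1 - 2 * a) * (h' x)\<^sup>2\<close>, which is nonpositive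
  for \<open>a \<ge> 1 / 2\<close>. Hence \<open>(h x)\<^sup>2 \<le> E x \<le> E 0 = 1\<close>. This is where the restriction on the
  shape parameter enters.\<close>

lemma norm_bessel_abs_le_1:
  assumes a: "a \<ge> 1 / 2" and x: "x \<ge> 0"
  shows "\<bar>norm_bessel a x\<bar> \<le> 1"
proof -
  have a0: "a > 0" using a by simp
  define E where "E = (\<lambda>x. (norm_bessel a x)\<^sup>2 + x * (norm_bessel (a + 1) x / a)\<^sup>2)"
  have "E x \<le> E 0"
  proof (rule DERIV_nonpos_imp_nonincreasing[OF x])
    fix y assume y: "0 \<le> y" "y \<le> x"
    have D1: "(norm_bessel a has_real_derivative - (1 / a) * norm_bessel (a + 1) y) (at y)"
      by (rule DERIV_norm_bessel[OF a0])
    have D2: "(norm_bessel (a + 1) has_real_derivative - (1 / (a + 1)) * norm_bessel (a + 2) y) (at y)"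
      using DERIV_norm_bessel[of "a + 1" y] a0 by (simp add: add_ac)
    let ?p = "norm_bessel a y" and ?q = "norm_bessel (a + 1) y" and ?r = "norm_bessel (a + 2) y"
    have "y / (a * (a + 1)) * ?r = ?q - ?p"
      using norm_bessel_recurrence[OF a0, of y] by simp
    then have rec: "y * ?r = a * (a + 1) * (?q - ?p)"
      using a0 by (simp add: divide_simps split: if_splits)
    have "(E has_real_derivative
        2 * ?p * (- (1 / a) * ?q) + ((?q / a)\<^sup>2 + 2 * ?q / a\<^sup>2 * (- (1 / (a + 1)) * (y * ?r)))) (at y)"
      unfolding E_def using a0
      by - (rule derivative_eq_intros D1 D2 refl | simp add: field_simps power2_eq_square)+
    also have "2 * ?p * (- (1 / a) * ?q) + ((?q / a)\<^sup>2 + 2 * ?q / a\<^sup>2 * (- (1 / (a + 1)) * (y * ?r)))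
        = (1 - 2 * a) * (?q / a)\<^sup>2"
      unfolding rec using a0 by (simp add: divide_simps) (simp add: algebra_simps power2_eq_square)
    finally have "(E has_real_derivative (1 - 2 * a) * (?q / a)\<^sup>2) (at y)" .
    moreover have "(1 - 2 * a) * (?q / a)\<^sup>2 \<le> 0"
      using a by (intro mult_nonpos_nonneg) auto
    ultimately show "\<exists>d. (E has_real_derivative d) (at y) \<and> d \<le> 0" by blast
  qed
  moreover have "(norm_bessel a x)\<^sup>2 \<le> E x" "E 0 = 1"
    using x by (auto simp: E_def)
  ultimately have "(norm_bessel a x)\<^sup>2 \<le> 1" by simp
  then show ?thesis by (simp add: abs_square_le_1)
qed

text \<open>The derivative is \<open>- norm_bessel (a + 1) / a\<close>, and the uniform bound applies to the shifted
  parameter as well.\<close>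

lemma norm_bessel_lipschitz:
  assumes a: "a \<ge> 1 / 2" and x: "x \<ge> 0" "y \<ge> 0"
  shows "\<bar>norm_bessel a x - norm_bessel a y\<bar> \<le> \<bar>x - y\<bar> / a"
proof -
  have "norm (norm_bessel a x - norm_bessel a y) \<le> 1 / a * norm (x - y)"
  proof (rule field_differentiable_bound[of "{0..}" _ "\<lambda>z. - (1 / a) * norm_bessel (a + 1) z"])
    fix z :: real assume z: "z \<in> {0..}"
    show "(norm_bessel a has_field_derivative - (1 / a) * norm_bessel (a + 1) z) (at z within {0..})"
      using DERIV_norm_bessel[of a z] a by (auto intro: DERIV_subset)
    show "norm (- (1 / a) * norm_bessel (a + 1) z) \<le> 1 / a"
      using norm_bessel_abs_le_1[of "a + 1" z] a z by (simp add: divide_simps abs_mult)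
  qed (use x in auto)
  then show ?thesis by simp
qed

lemma Gamma_mult_hankel_kernel:
  assumes a: "a > 0" and x: "x \<ge> 0"
  shows "Gamma a * hankel_kernel a x = norm_bessel a x"
proof (cases "x = 0")
  case True
  have "Gamma a \<noteq> 0" using Gamma_real_pos[OF a] by simp
  then show ?thesis using True by (simp add: hankel_kernel_def)
next
  case False
  with x have x: "x > 0" by simp
  have G: "Gamma (a + real j) = pochhammer a j * Gamma a" for j
  proof -
    have "a \<notin> \<int>\<^sub>\<le>\<^sub>0" using a by (auto elim!: nonpos_Ints_cases)
    then show ?thesis
      using pochhammer_Gamma[of a j] Gamma_real_pos[OF a] by (simp add: field_simps)
  qed
  have c: "(-1) ^ j / (fact j * Gamma (a - 1 + 1 + real j)) * (2 * sqrt x / 2) powr (2 * real j + (a - 1))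
      = x powr ((a - 1) / 2) / Gamma a * (norm_bessel_coeff a j * x ^ j)" for j
  proof -
    have "sqrt x powr (2 * real j + (a - 1)) = x powr (real j + (a - 1) / 2)"
      using x by (simp add: powr_half_sqrt[symmetric] powr_powr field_simps)
    also have "\<dots> = x ^ j * x powr ((a - 1) / 2)"
      using x by (simp add: powr_add powr_realpow)
    finally show ?thesis
      by (simp add: G norm_bessel_coeff_def mult_ac)
  qed
  have "bessel_J (a - 1) (2 * sqrt x) = x powr ((a - 1) / 2) / Gamma a * norm_bessel a x"
    unfolding bessel_J_def c norm_bessel_def
    using summable_norm_bessel[OF a, of x] by (subst suminf_mult) auto
  moreover have "x powr ((1 - a) / 2) * x powr ((a - 1) / 2) = 1"
    using x by (simp add: powr_add[symmetric] add_divide_distrib[symmetric])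
  moreover have "Gamma a \<noteq> 0" using Gamma_real_pos[OF a] by simp
  ultimately show ?thesis
    using x by (simp add: hankel_kernel_def)
qed

lemma borel_measurable_hankel_kernel [measurable]: "hankel_kernel a \<in> borel_measurable borel"
proof -
  have [measurable]: "bessel_J \<nu> \<in> borel_measurable borel" for \<nu>
    unfolding bessel_J_def[abs_def] by measurable
  show ?thesis unfolding hankel_kernel_def[abs_def] by measurable
qed

section \<open>Gamma distributions and the Hankel transform\<close>

lemma borel_measurable_gamma_density [measurable]: "gamma_density a s \<in> borel_measurable borel"
  unfolding gamma_density_def[abs_def] by measurable

lemma sets_gamma_dist [simp, measurable_cong]: "sets (gamma_dist a s) = sets borel"
  by (simp add: gamma_dist_def)

lemma space_gamma_dist [simp]: "space (gamma_dist a s) = UNIV"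
  by (simp add: gamma_dist_def)

lemma gamma_density_nonneg: "a > 0 \<Longrightarrow> gamma_density a s x \<ge> 0"
  using Gamma_real_pos[of a] by (simp add: gamma_density_def)

lemma nn_integral_gamma_density:
  assumes a: "a > 0" and s: "s > 0"
  shows "(\<integral>\<^sup>+x. ennreal (gamma_density a s x) \<partial>lborel) = 1"
proof -
  have G: "Gamma a > 0" by (rule Gamma_real_pos[OF a])
  let ?f = "\<lambda>t. ennreal (indicator {0..} t * t powr (a - 1) / exp t)"
  have "ennreal (Gamma a) = (\<integral>\<^sup>+t. ?f t \<partial>lborel)"
    by (rule Gamma_conv_nn_integral_real[OF a])
  also have "\<dots> = \<bar>s\<bar> * (\<integral>\<^sup>+x. ?f (0 + s * x) \<partial>lborel)"
    using s by (intro nn_integral_real_affine) auto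
  also have "\<dots> = (\<integral>\<^sup>+x. ennreal s * ?f (s * x) \<partial>lborel)"
    using s by (subst nn_integral_cmult) auto
  also have "\<dots> = (\<integral>\<^sup>+x. ennreal (Gamma a) * ennreal (gamma_density a s x) \<partial>lborel)"
  proof (intro nn_integral_cong)
    fix x :: real
    have "s * (indicator {0..} (s * x) * (s * x) powr (a - 1) / exp (s * x)) = Gamma a * gamma_density a s x"
    proof (cases "x > 0")
      case True
      have "s * s powr (a - 1) = s powr a"
        using s by (simp add: powr_diff)
      then show ?thesis
        using True s G by (simp add: gamma_density_def powr_mult exp_minus field_simps)
    qed (use s in \<open>auto simp: gamma_density_def indicator_def zero_le_mult_iff\<close>)
    then show "ennreal s * ?f (s * x) = ennreal (Gamma a) * ennreal (gamma_density a s x)"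
      using s G by (simp add: ennreal_mult'[symmetric])
  qed
  also have "\<dots> = ennreal (Gamma a) * (\<integral>\<^sup>+x. ennreal (gamma_density a s x) \<partial>lborel)"
    by (intro nn_integral_cmult) simp
  finally have "ennreal (Gamma a) * 1 = ennreal (Gamma a) * (\<integral>\<^sup>+x. ennreal (gamma_density a s x) \<partial>lborel)"
    by simp
  then show ?thesis
    using G by (subst (asm) ennreal_mult_cancel_left) auto
qed

lemma prob_space_gamma_dist:
  assumes "a > 0" "s > 0"
  shows "prob_space (gamma_dist a s)"
  using nn_integral_gamma_density[OF assms]
  by (intro prob_spaceI) (simp add: gamma_dist_def emeasure_density)

lemma AE_gamma_dist_pos: "AE x in gamma_dist a s. x > 0"
  unfolding gamma_dist_def by (subst AE_density) (auto simp: gamma_density_def)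

text \<open>All Gamma laws of a fixed shape have the same null sets, as their densities vanish exactly off
  the positive half-line. So an identity known almost everywhere under one rate may be integrated
  against any other rate.\<close>

lemma AE_gamma_dist_change_rate:
  assumes a: "a > 0" and P: "AE t in gamma_dist a s. P t" and s: "s > 0" and s': "s' > 0"
    and [measurable]: "Measurable.pred borel P"
  shows "AE t in gamma_dist a s'. P t"
proof -
  have "gamma_density a r t > 0 \<longleftrightarrow> t > 0" if "r > 0" for r t
    using that Gamma_real_pos[OF a] by (auto simp: gamma_density_def)
  then show ?thesis
    using P s s' unfolding gamma_dist_def by (simp add: AE_density)
qed

lemma has_bochner_integral_gamma_dist_power:
  assumes a: "a > 0" and s: "s > 0"
  shows "has_bochner_integral (gamma_dist a s) (\<lambda>x. x ^ k) (pochhammer a k / s ^ k)"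
proof (rule has_bochner_integral_nn_integral)
  have G: "Gamma a > 0" "pochhammer a k > 0" using a by (auto intro: Gamma_real_pos pochhammer_pos)
  have "a \<notin> \<int>\<^sub>\<le>\<^sub>0" using a by (auto elim!: nonpos_Ints_cases)
  then have Gk: "Gamma (a + real k) = pochhammer a k * Gamma a"
    using pochhammer_Gamma[of a k] G by (simp add: field_simps)
  have "(\<integral>\<^sup>+x. ennreal (x ^ k) \<partial>gamma_dist a s)
      = (\<integral>\<^sup>+x. ennreal (gamma_density a s x) * ennreal (x ^ k) \<partial>lborel)"
    unfolding gamma_dist_def by (subst nn_integral_density) auto
  also have "\<dots> = (\<integral>\<^sup>+x. ennreal (pochhammer a k / s ^ k) * ennreal (gamma_density (a + k) s x) \<partial>lborel)"
  proof (intro nn_integral_cong)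
    fix x :: real
    have "gamma_density a s x * x ^ k = pochhammer a k / s ^ k * gamma_density (a + k) s x"
    proof (cases "x > 0")
      case True
      have "s powr (a + k) = s powr a * s ^ k" "x powr (a + k - 1) = x powr (a - 1) * x ^ k"
        using s True by (simp_all add: powr_add powr_diff powr_realpow)
      then show ?thesis
        using True s G by (simp add: gamma_density_def Gk field_simps)
    qed (simp add: gamma_density_def)
    then show "ennreal (gamma_density a s x) * ennreal (x ^ k)
        = ennreal (pochhammer a k / s ^ k) * ennreal (gamma_density (a + k) s x)"
      using a s G by (simp add: ennreal_mult'[symmetric] gamma_density_nonneg)
  qed
  also have "\<dots> = ennreal (pochhammer a k / s ^ k)"
    using nn_integral_gamma_density[of "a + k" s] a s by (subst nn_integral_cmult) auto
  finally show "(\<integral>\<^sup>+x. ennreal (x ^ k) \<partial>gamma_dist a s) = ennreal (pochhammer a k / s ^ k)" .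
  show "AE x in gamma_dist a s. 0 \<le> x ^ k"
    using AE_gamma_dist_pos by eventually_elim simp
  show "0 \<le> pochhammer a k / s ^ k"
    using G s by simp
qed simp

text \<open>The key identity. The \<open>j\<close>-th moment of the Gamma law is \<open>pochhammer a j / s ^ j\<close>, which cancels
  the Pochhammer symbol in the \<open>j\<close>-th coefficient of the kernel, so integrating termwise leaves the
  exponential series. It has two uses: read with the observation integrated, it says that the Hankel
  transform of a Gamma law is exponential; read with the dual variable integrated, it
  turns a Hankel transform into a Laplace transform.\<close>

lemma gamma_dist_integral_norm_bessel:
  assumes a: "a > 0" and s: "s > 0"
  shows "(\<integral>t. norm_bessel a (t * x) \<partial>gamma_dist a s) = exp (- x / s)"
proof -
  let ?G = "gamma_dist a s"
  let ?f = "\<lambda>j t. norm_bessel_coeff a j * (t * x) ^ j"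
  have p: "pochhammer a j > 0" for j using a by (rule pochhammer_pos)
  have f: "has_bochner_integral ?G (?f j) ((- x / s) ^ j / fact j)" for j
  proof -
    have "has_bochner_integral ?G (\<lambda>t. (norm_bessel_coeff a j * x ^ j) * t ^ j)
        ((norm_bessel_coeff a j * x ^ j) * (pochhammer a j / s ^ j))"
      by (intro has_bochner_integral_mult_right has_bochner_integral_gamma_dist_power a s)
    moreover have "(norm_bessel_coeff a j * x ^ j) * (pochhammer a j / s ^ j) = (- x / s) ^ j / fact j"
      using p[of j] s by (simp add: norm_bessel_coeff_def power_divide power_minus' field_simps)
    ultimately show ?thesis by (simp add: power_mult_distrib mult_ac)
  qed
  have n: "(\<integral>t. norm (?f j t) \<partial>?G) = \<bar>x / s\<bar> ^ j / fact j" for j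
  proof -
    have "(\<integral>t. norm (?f j t) \<partial>?G) = (\<integral>t. (\<bar>norm_bessel_coeff a j\<bar> * \<bar>x\<bar> ^ j) * t ^ j \<partial>?G)"
    proof (rule integral_cong_AE)
      show "AE t in ?G. norm (?f j t) = (\<bar>norm_bessel_coeff a j\<bar> * \<bar>x\<bar> ^ j) * t ^ j"
        using AE_gamma_dist_pos
        by eventually_elim (simp add: abs_mult power_abs power_mult_distrib)
    qed measurable
    also have "\<dots> = (\<bar>norm_bessel_coeff a j\<bar> * \<bar>x\<bar> ^ j) * (pochhammer a j / s ^ j)"
      by (intro has_bochner_integral_integral_eq has_bochner_integral_mult_right
          has_bochner_integral_gamma_dist_power a s)
    also have "\<dots> = \<bar>x / s\<bar> ^ j / fact j"
      using p[of j] s by (simp add: norm_bessel_coeff_def abs_mult power_divide power_abs)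
    finally show ?thesis .
  qed
  have "(\<integral>t. norm_bessel a (t * x) \<partial>?G) = (\<Sum>j. \<integral>t. ?f j t \<partial>?G)"
    unfolding norm_bessel_def
  proof (rule integral_suminf)
    show "integrable ?G (?f j)" for j using f[of j] by (simp add: has_bochner_integral_iff)
    show "AE t in ?G. summable (\<lambda>j. norm (?f j t))"
    proof (intro AE_I2)
      fix t
      have "summable (\<lambda>j. norm_bessel_coeff a j * (\<bar>t * x\<bar> + 1) ^ j)"
        using a by (rule summable_norm_bessel)
      then show "summable (\<lambda>j. norm (?f j t))"
        by (rule powser_insidea) simp
    qed
    show "summable (\<lambda>j. \<integral>t. norm (?f j t) \<partial>?G)"
      unfolding n using summable_exp[of "\<bar>x / s\<bar>"] by (simp add: field_simps)
  qed
  also have "\<dots> = (\<Sum>j. (- x / s) ^ j / fact j)"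
    using f by (simp add: has_bochner_integral_iff)
  also have "\<dots> = exp (- x / s)"
    unfolding exp_def by (simp add: field_simps)
  finally show ?thesis .
qed

section \<open>Uniqueness of Laplace transforms\<close>

text \<open>The values of the Laplace transform at the natural numbers are the moments of \<open>exp (- x)\<close>. On
  the nonnegative half-line this variable lies in the unit interval, so its characteristic function is
  the convergent power series formed from these moments. Equality of the laws of \<open>exp (- x)\<close> follows
  from the uniqueness theorem for characteristic functions, and applying \<open>- ln\<close> recovers the laws
  of \<open>x\<close>.\<close>

lemma laplace_uniqueness_nat:
  fixes M N :: "real measure"
  assumes M: "prob_space M" "sets M = sets borel" "AE x in M. x \<ge> 0"
    and N: "prob_space N" "sets N = sets borel" "AE x in N. x \<ge> 0"
    and eq: "\<And>k::nat. k > 0 \<Longrightarrow> (\<integral>x. exp (- real k * x) \<partial>M) = (\<integral>x. exp (- real k * x) \<partial>N)"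
  shows "M = N"
proof -
  have char: "char (distr P borel (\<lambda>x. exp (- x))) \<theta>
      = (\<Sum>k. (\<i> * \<theta>) ^ k / fact k * complex_of_real (\<integral>x. exp (- real k * x) \<partial>P))"
    if P: "prob_space P" "sets P = sets borel" "AE x in P. x \<ge> 0" for P :: "real measure" and \<theta> :: real
  proof -
    interpret prob_space P by fact
    note [measurable_cong] = P(2)
    let ?f = "\<lambda>k x. (\<i> * \<theta>) ^ k / fact k * complex_of_real (exp (- real k * x))"
    have ie: "integrable P (\<lambda>x. exp (- real k * x))" for k :: nat
      using P(3) by (intro integrable_const_bound[where B = 1]) (auto elim!: eventually_mono)
    have nf: "norm (?f k x) = \<bar>\<theta>\<bar> ^ k / fact k * exp (- real k * x)" for k x
      by (simp add: norm_mult norm_divide norm_power)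
    have sum: "summable (\<lambda>k. \<bar>\<theta>\<bar> ^ k / fact k)"
      using summable_exp[of "\<bar>\<theta>\<bar>"] by (simp add: field_simps)
    have ser: "iexp (\<theta> * exp (- x)) = (\<Sum>k. ?f k x)" for x
    proof -
      have "?f k x = (\<i> * complex_of_real (\<theta> * exp (- x))) ^ k /\<^sub>R fact k" for k
      proof -
        have "exp (- real k * x) = exp (- x) ^ k"
          by (simp add: exp_of_nat_mult[symmetric])
        then show ?thesis
          by (simp add: power_mult_distrib scaleR_conv_of_real field_simps)
      qed
      then show ?thesis by (simp add: exp_def)
    qed
    have "char (distr P borel (\<lambda>x. exp (- x))) \<theta> = (\<integral>x. iexp (\<theta> * exp (- x)) \<partial>P)"
      unfolding char_def by (subst integral_distr) auto
    also have "\<dots> = (\<integral>x. (\<Sum>k. ?f k x) \<partial>P)"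
      unfolding ser ..
    also have "\<dots> = (\<Sum>k. \<integral>x. ?f k x \<partial>P)"
    proof (rule integral_suminf)
      show "integrable P (?f k)" for k
        by (intro integrable_mult_right integrable_of_real ie)
      show "AE x in P. summable (\<lambda>k. norm (?f k x))"
        using P(3)
      proof eventually_elim
        case (elim x)
        show ?case
          unfolding nf using elim
          by (intro summable_comparison_test[OF _ sum] exI[of _ 0]) (auto simp: mult_left_le divide_right_mono)
      qed
      show "summable (\<lambda>k. \<integral>x. norm (?f k x) \<partial>P)"
      proof (intro summable_comparison_test[OF _ sum] exI[of _ 0] allI impI)
        fix k
        have "(\<integral>x. exp (- real k * x) \<partial>P) \<le> 1"
          using P(3) ie by (intro integral_le_const) (auto elim!: eventually_mono)
        then show "norm (\<integral>x. norm (?f k x) \<partial>P) \<le> \<bar>\<theta>\<bar> ^ k / fact k"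
          unfolding nf by (simp add: abs_mult mult_left_le divide_right_mono)
      qed
    qed
    also have "\<dots> = (\<Sum>k. (\<i> * \<theta>) ^ k / fact k * complex_of_real (\<integral>x. exp (- real k * x) \<partial>P))"
      by (intro suminf_cong) (simp only: integral_mult_right_zero integral_complex_of_real)
    finally show ?thesis .
  qed
  have eq': "(\<integral>x. exp (- real k * x) \<partial>M) = (\<integral>x. exp (- real k * x) \<partial>N)" for k :: nat
    using eq[of k] M(1) N(1) by (cases "k = 0") (auto simp: prob_space.prob_space)
  have D: "distr M borel (\<lambda>x. exp (- x)) = distr N borel (\<lambda>x. exp (- x))"
  proof (rule Levy_uniqueness)
    have rd: "real_distribution (distr P borel (\<lambda>x. exp (- x)))"
      if "prob_space P" "sets P = sets borel" for P :: "real measure"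
      using that by (intro prob_space.real_distribution_distr) (auto cong: measurable_cong_sets)
    show "real_distribution (distr M borel (\<lambda>x. exp (- x)))"
      "real_distribution (distr N borel (\<lambda>x. exp (- x)))"
      by (intro rd M N)+
    show "char (distr M borel (\<lambda>x. exp (- x))) = char (distr N borel (\<lambda>x. exp (- x)))"
      by (intro ext) (simp only: char[OF M] char[OF N] eq')
  qed
  have recover: "P = distr (distr P borel (\<lambda>x. exp (- x))) borel (\<lambda>z. - ln z)"
    if "sets P = sets borel" for P :: "real measure"
    using that by (subst distr_distr) (auto cong: measurable_cong_sets simp: comp_def intro!: distr_id2[symmetric])
  show ?thesis
    using recover[OF M(2)] recover[OF N(2)] D by simp
qed

section \<open>The empirical and the population transform\<close>

text \<open>Only arguments \<open>x \<ge> 0\<close> occur in the statistic, up to null sets. Reflecting the kernel keeps it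
  bounded and Lipschitz on the whole line, so that integrability and measurability need no case
  distinctions.\<close>

definition even_kernel :: "real \<Rightarrow> real \<Rightarrow> real" where
  "even_kernel a x = norm_bessel a \<bar>x\<bar>"

lemma borel_measurable_even_kernel [measurable]:
  "a > 0 \<Longrightarrow> even_kernel a \<in> borel_measurable borel"
  unfolding even_kernel_def[abs_def]
  by (intro borel_measurable_continuous_onI continuous_at_imp_continuous_on ballI
      isCont_o2[OF _ isCont_norm_bessel]) auto

lemma even_kernel_abs_le_1: "a \<ge> 1 / 2 \<Longrightarrow> \<bar>even_kernel a x\<bar> \<le> 1"
  unfolding even_kernel_def by (rule norm_bessel_abs_le_1) auto

lemma even_kernel_lipschitz:
  assumes a: "a \<ge> 1 / 2"
  shows "\<bar>even_kernel a x - even_kernel a y\<bar> \<le> \<bar>x - y\<bar> / a"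
proof -
  have "\<bar>even_kernel a x - even_kernel a y\<bar> \<le> \<bar>\<bar>x\<bar> - \<bar>y\<bar>\<bar> / a"
    unfolding even_kernel_def by (rule norm_bessel_lipschitz[OF a]) auto
  also have "\<dots> \<le> \<bar>x - y\<bar> / a"
    using a by (intro divide_right_mono) auto
  finally show ?thesis .
qed

text \<open>The scale \<open>m\<close> is a parameter because the statistic divides by the sample mean, whereas the law
  of large numbers applies to division by the true mean.\<close>

definition empirical_transform :: "real \<Rightarrow> nat \<Rightarrow> (nat \<Rightarrow> real) \<Rightarrow> real \<Rightarrow> real \<Rightarrow> real" where
  "empirical_transform a n x m t = (\<Sum>j<n. even_kernel a (t * (x j / m))) / real n"

definition hankel_transform :: "real \<Rightarrow> real measure \<Rightarrow> real \<Rightarrow> real" where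
  "hankel_transform a D t = (\<integral>x. even_kernel a (t * (x / (\<integral>y. y \<partial>D))) \<partial>D)"

text \<open>The population counterpart of \<open>T2 / n\<close>. Here \<open>\<bar>t\<bar> = t\<close> almost everywhere, and the
  absolute value keeps the integrand bounded, as for the kernel.\<close>

definition discrepancy :: "real \<Rightarrow> real measure \<Rightarrow> real" where
  "discrepancy a D = (\<integral>t. (hankel_transform a D t - exp (- \<bar>t\<bar> / a))\<^sup>2 \<partial>gamma_dist a 1)"

lemma T2_eq:
  assumes a: "a \<ge> 1 / 2" and x: "\<And>j. j < n \<Longrightarrow> x j \<ge> 0"
  shows "T2 a n x = real n *
    (\<integral>t. (empirical_transform a n x (sample_mean n x) t - exp (- \<bar>t\<bar> / a))\<^sup>2 \<partial>gamma_dist a 1)"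
proof -
  have a0: "a > 0" using a by simp
  note [measurable] = borel_measurable_even_kernel[OF a0]
  have m: "sample_mean n x \<ge> 0"
    using x by (auto simp: sample_mean_def intro!: divide_nonneg_nonneg sum_nonneg)
  have sc: "scaled_obs n x j = x j / sample_mean n x" for j
    by (simp add: scaled_obs_def)
  have "AE t in gamma_dist a 1.
    indicator {0<..} t *\<^sub>R ((\<Sum>j<n. Gamma a * hankel_kernel a (t * scaled_obs n x j)) / real n - exp (- t / a))\<^sup>2
    = (empirical_transform a n x (sample_mean n x) t - exp (- \<bar>t\<bar> / a))\<^sup>2"
    using AE_gamma_dist_pos
  proof eventually_elim
    case (elim t)
    have "Gamma a * hankel_kernel a (t * scaled_obs n x j) = even_kernel a (t * (x j / sample_mean n x))"
      if "j < n" for j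
      using elim m x[OF that] a0
      by (subst Gamma_mult_hankel_kernel) (auto simp: sc even_kernel_def)
    then show ?case using elim by (simp add: empirical_transform_def)
  qed
  then show ?thesis
    unfolding T2_def set_lebesgue_integral_def empirical_transform_def
    by (subst integral_cong_AE) auto
qed

lemma integrable_square_of_bounded:
  fixes f :: "'a \<Rightarrow> real"
  assumes "prob_space N" "f \<in> borel_measurable N" "\<And>x. \<bar>f x\<bar> \<le> K"
  shows "integrable N (\<lambda>x. (f x)\<^sup>2)"
proof -
  interpret N: prob_space N by fact
  show ?thesis
  proof (rule N.integrable_const_bound[where B = "K\<^sup>2"])
    show "(\<lambda>x. (f x)\<^sup>2) \<in> borel_measurable N" using assms(2) by simp
    show "AE x in N. norm ((f x)\<^sup>2) \<le> K\<^sup>2"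
      using power_mono[OF assms(3) abs_ge_zero, where n = 2] by simp
  qed
qed

lemma abs_diff_squares_le:
  fixes u e p :: real
  assumes "\<bar>u - e\<bar> \<le> 2" "\<bar>p - e\<bar> \<le> 2"
  shows "\<bar>(u - e)\<^sup>2 - (p - e)\<^sup>2\<bar> \<le> 4 * \<bar>u - p\<bar>"
proof -
  have "(u - e)\<^sup>2 - (p - e)\<^sup>2 = ((u - e) + (p - e)) * (u - p)"
    by (simp add: power2_eq_square algebra_simps)
  moreover have "\<bar>(u - e) + (p - e)\<bar> \<le> 4" using assms by linarith
  ultimately show ?thesis by (simp only: abs_mult mult_right_mono abs_ge_zero)
qed

section \<open>Laws of large numbers in mean\<close>

text \<open>The locale fixes the law of a single observation. Everything about samples is proved on the
  product space \<open>sample n\<close>, which serves both for the null hypothesis and, through the joint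
  distribution, for the given observations.\<close>

locale nonneg_law = D: prob_space D for D :: "real measure" +
  fixes a :: real
  assumes a_ge: "a \<ge> 1 / 2"
    and sets_D [measurable_cong]: "sets D = sets borel"
    and nonneg: "AE x in D. x \<ge> 0"
    and integrable_D: "integrable D (\<lambda>x. x)"
begin

lemma measurable_D: "f \<in> borel_measurable borel \<Longrightarrow> f \<in> borel_measurable D"
  by (simp cong: measurable_cong_sets add: sets_D)

lemma a_pos: "a > 0" using a_ge by simp

lemmas even_kernel_measurable [measurable] = borel_measurable_even_kernel[OF a_pos]

abbreviation "\<mu> \<equiv> (\<integral>x. x \<partial>D)"

abbreviation "sample n \<equiv> (\<Pi>\<^sub>M j\<in>{..<n::nat}. D)"

abbreviation "G \<equiv> gamma_dist a 1"

sublocale G: prob_space G by (rule prob_space_gamma_dist[OF a_pos]) simp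

sublocale product_prob_space "\<lambda>_::nat. D"
  by (unfold_locales)

sublocale S: prob_space "sample n" for n
  by (intro prob_space_PiM D.prob_space_axioms)

lemma sample_measurable_component [measurable (raw)]:
  "j < n \<Longrightarrow> (\<lambda>x. x j) \<in> borel_measurable (sample n)"
  using measurable_component_singleton[of j "{..<n}" "\<lambda>_. D"] by (simp cong: measurable_cong_sets)

lemma sample_AE: "AE x in D. Q x \<Longrightarrow> AE x in sample n. \<forall>j<n. Q (x j)"
proof -
  assume Q: "AE x in D. Q x"
  have "AE x in sample n. \<forall>j\<in>{..<n}. Q (x j)"
    using AE_PiM_component[of "{..<n}" "\<lambda>_. D", OF D.prob_space_axioms _ Q] by (subst AE_finite_all) auto
  then show ?thesis by eventually_elim auto
qed

lemma sample_integral: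
  fixes f :: "real \<Rightarrow> real"
  assumes f: "integrable D f" and j: "j < n"
  shows "integrable (sample n) (\<lambda>x. f (x j))" "(\<integral>x. f (x j) \<partial>sample n) = (\<integral>x. f x \<partial>D)"
proof -
  have d: "distr (sample n) D (\<lambda>x. x j) = D"
    using j by (intro distr_PiM_component D.prob_space_axioms) auto
  have [measurable]: "(\<lambda>x. x j) \<in> sample n \<rightarrow>\<^sub>M D"
    using j by (intro measurable_component_singleton) auto
  have [measurable]: "f \<in> borel_measurable D" using f by auto
  show "integrable (sample n) (\<lambda>x. f (x j))"
    using f integrable_distr_eq[of "\<lambda>x. x j" "sample n" D f] d by simp
  show "(\<integral>x. f (x j) \<partial>sample n) = (\<integral>x. f x \<partial>D)"
    using integral_distr[of "\<lambda>x. x j" "sample n" D f] d by simp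
qed

lemma sample_integral_mult_centred:
  fixes g :: "real \<Rightarrow> real"
  assumes g: "integrable D g" "(\<integral>x. g x \<partial>D) = 0" and ij: "i < n" "j < n" "i \<noteq> j"
  shows "(\<integral>x. g (x i) * g (x j) \<partial>sample n) = 0"
proof -
  let ?f = "\<lambda>k. if k \<in> {i, j} then g else (\<lambda>_. 1)"
  have "(\<integral>x. g (x i) * g (x j) \<partial>sample n) = (\<integral>x. (\<Prod>k\<in>{..<n}. ?f k (x k)) \<partial>sample n)"
  proof (intro Bochner_Integration.integral_cong refl)
    fix x
    have "(\<Prod>k\<in>{..<n}. ?f k (x k)) = (\<Prod>k\<in>{i, j}. ?f k (x k))"
      using ij by (intro prod.mono_neutral_right) auto
    then show "g (x i) * g (x j) = (\<Prod>k\<in>{..<n}. ?f k (x k))" using ij by simp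
  qed
  also have "\<dots> = (\<Prod>k\<in>{..<n}. (\<integral>x. ?f k x \<partial>D))"
    using g by (intro product_integral_prod) auto
  also have "\<dots> = 0"
    using g ij by (intro prod_zero bexI[of _ i]) auto
  finally show ?thesis .
qed

text \<open>For bounded observables the variance of the average is at most \<open>K\<^sup>2 / n\<close>, since the centred
  terms are orthogonal; the first absolute moment is at most the root of the second. The bound
  depends on \<open>f\<close> only through \<open>K\<close>, so it is uniform in \<open>t\<close> when \<open>f\<close> is the kernel at
  the point \<open>t\<close>.\<close>

lemma sample_average_deviation_le:
  fixes f :: "real \<Rightarrow> real"
  assumes f [measurable]: "f \<in> borel_measurable borel" and K: "\<And>x. \<bar>f x\<bar> \<le> K" and n: "n > 0"
  shows "(\<integral>x. \<bar>(\<Sum>j<n. f (x j)) / real n - (\<integral>y. f y \<partial>D)\<bar> \<partial>sample n) \<le> K / sqrt (real n)"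
proof -
  define c where "c = (\<integral>y. f y \<partial>D)"
  define g where "g = (\<lambda>y. f y - c)"
  have K0: "K \<ge> 0" using K[of 0] by linarith
  have intf: "integrable D f"
    by (rule D.integrable_const_bound[where B = K]) (simp_all add: K measurable_D f)
  have intf2: "integrable D (\<lambda>y. (f y)\<^sup>2)"
    by (rule integrable_square_of_bounded[OF D.prob_space_axioms measurable_D[OF f] K])
  have c: "\<bar>c\<bar> \<le> K"
    unfolding c_def
    by (intro order_trans[OF integral_abs_bound] D.integral_le_const integrable_abs intf AE_I2 K)
  have [measurable]: "g \<in> borel_measurable borel" unfolding g_def by measurable
  have gb: "\<bar>g y\<bar> \<le> 2 * K" for y using K[of y] c unfolding g_def by linarith
  have intg: "integrable D g" "(\<integral>y. g y \<partial>D) = 0"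
    using intf D.prob_space by (auto simp: g_def c_def)
  have intg2: "integrable D (\<lambda>y. (g y)\<^sup>2)"
    by (rule integrable_square_of_bounded[OF D.prob_space_axioms measurable_D gb]) measurable
  have "(\<integral>y. (g y)\<^sup>2 \<partial>D) = (\<integral>y. (f y)\<^sup>2 \<partial>D) - c\<^sup>2"
    using D.variance_eq[OF intf intf2] by (simp add: g_def c_def)
  also have "\<dots> \<le> (\<integral>y. (f y)\<^sup>2 \<partial>D)" by simp
  also have "\<dots> \<le> K\<^sup>2"
    using power_mono[OF K abs_ge_zero, where n = 2] by (intro D.integral_le_const[OF intf2]) simp
  finally have var: "(\<integral>y. (g y)\<^sup>2 \<partial>D) \<le> K\<^sup>2" .
  define Z where "Z = (\<lambda>x. (\<Sum>j<n. g (x j)) / real n)"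
  have Zm [measurable]: "Z \<in> borel_measurable (sample n)"
    unfolding Z_def by measurable
  have Zb: "\<bar>Z x\<bar> \<le> 2 * K" for x
  proof -
    have "\<bar>\<Sum>j<n. g (x j)\<bar> \<le> (\<Sum>j<n. 2 * K)"
      using gb by (intro order_trans[OF sum_abs] sum_mono)
    then show ?thesis using n by (simp add: Z_def field_simps)
  qed
  have intZ: "integrable (sample n) (\<lambda>x. \<bar>Z x\<bar>)"
    using Zb by (intro S.integrable_const_bound[where B = "2 * K"]) auto
  have intZ2: "integrable (sample n) (\<lambda>x. \<bar>Z x\<bar>\<^sup>2)"
    unfolding power2_abs
    by (rule integrable_square_of_bounded[OF S.prob_space_axioms Zm Zb])
  have intgg: "integrable (sample n) (\<lambda>x. g (x i) * g (x j))" if "i < n" "j < n" for i j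
  proof (rule S.integrable_const_bound[where B = "2 * K * (2 * K)"])
    show "AE x in sample n. norm (g (x i) * g (x j)) \<le> 2 * K * (2 * K)"
      unfolding real_norm_def abs_mult using K0 by (intro AE_I2 mult_mono gb) auto
    show "(\<lambda>x. g (x i) * g (x j)) \<in> borel_measurable (sample n)"
      using that by measurable
  qed
  have "(\<integral>x. \<bar>Z x\<bar>\<^sup>2 \<partial>sample n) = (\<integral>x. (\<Sum>i<n. \<Sum>j<n. g (x i) * g (x j)) / (real n)\<^sup>2 \<partial>sample n)"
    unfolding power2_abs Z_def power_divide by (simp only: power2_eq_square sum_product)
  also have "\<dots> = (\<Sum>i<n. \<Sum>j<n. (\<integral>x. g (x i) * g (x j) \<partial>sample n)) / (real n)\<^sup>2"
    by (subst integral_divide_zero, subst Bochner_Integration.integral_sum)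
      (auto intro!: intgg sum.cong Bochner_Integration.integral_sum Bochner_Integration.integrable_sum
        arg_cong2[where f = "(/)"])
  also have "(\<Sum>i<n. \<Sum>j<n. (\<integral>x. g (x i) * g (x j) \<partial>sample n)) = (\<Sum>i<n. (\<integral>y. (g y)\<^sup>2 \<partial>D))"
  proof (intro sum.cong refl)
    fix i assume i: "i \<in> {..<n}"
    have "(\<Sum>j<n. (\<integral>x. g (x i) * g (x j) \<partial>sample n)) = (\<Sum>j\<in>{i}. (\<integral>x. g (x i) * g (x j) \<partial>sample n))"
      using i sample_integral_mult_centred[OF intg] by (intro sum.mono_neutral_right) auto
    also have "\<dots> = (\<integral>y. (g y)\<^sup>2 \<partial>D)"
      using i sample_integral(2)[OF intg2, of i n] by (simp add: power2_eq_square)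
    finally show "(\<Sum>j<n. (\<integral>x. g (x i) * g (x j) \<partial>sample n)) = (\<integral>y. (g y)\<^sup>2 \<partial>D)" .
  qed
  also have "\<dots> / (real n)\<^sup>2 \<le> (real n * K\<^sup>2) / (real n)\<^sup>2"
    using var by (intro divide_right_mono) (auto intro: mult_left_mono)
  also have "\<dots> = (K / sqrt (real n))\<^sup>2"
    using n by (simp add: power_divide power2_eq_square)
  finally have Z2: "(\<integral>x. \<bar>Z x\<bar>\<^sup>2 \<partial>sample n) \<le> (K / sqrt (real n))\<^sup>2" .
  have "(\<integral>x. \<bar>Z x\<bar> \<partial>sample n)\<^sup>2 \<le> (\<integral>x. \<bar>Z x\<bar>\<^sup>2 \<partial>sample n)"
    using S.variance_eq[OF intZ intZ2] S.variance_positive[where n = n and X = "\<lambda>x. \<bar>Z x\<bar>"] by linarith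
  then have "(\<integral>x. \<bar>Z x\<bar> \<partial>sample n)\<^sup>2 \<le> (K / sqrt (real n))\<^sup>2" using Z2 by linarith
  moreover have "0 \<le> K / sqrt (real n)" using K0 by simp
  ultimately have "(\<integral>x. \<bar>Z x\<bar> \<partial>sample n) \<le> K / sqrt (real n)"
    by (rule power2_le_imp_le)
  moreover have "Z = (\<lambda>x. (\<Sum>j<n. f (x j)) / real n - c)"
    using n by (simp add: Z_def g_def fun_eq_iff sum_subtractf diff_divide_distrib)
  ultimately show ?thesis unfolding c_def by simp
qed

lemma sample_mean_measurable [measurable]: "sample_mean n \<in> borel_measurable (sample n)"
  unfolding sample_mean_def[abs_def] by measurable

lemma sample_mean_integrable: "integrable (sample n) (\<lambda>x. \<bar>sample_mean n x - \<mu>\<bar>)"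
  unfolding sample_mean_def
  by (intro integrable_abs Bochner_Integration.integrable_diff integrable_divide
      Bochner_Integration.integrable_sum sample_integral(1)[OF integrable_D]) auto

text \<open>Truncation at level \<open>K\<close> yields a bounded observable, to which the variance bound applies; the
  error of truncation is paid twice, once in the sample and once in the mean.\<close>

lemma sample_mean_L1_bound:
  assumes K: "K \<ge> 0" and n: "n > 0"
  shows "(\<integral>x. \<bar>sample_mean n x - \<mu>\<bar> \<partial>sample n)
    \<le> K / sqrt (real n) + 2 * (\<integral>y. \<bar>y - max (- K) (min K y)\<bar> \<partial>D)"
proof -
  define f :: "real \<Rightarrow> real" where "f = (\<lambda>y. max (- K) (min K y))"
  define r where "r = (\<lambda>y. \<bar>y - f y\<bar>)"
  have [measurable]: "f \<in> borel_measurable borel" unfolding f_def by measurable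
  have fb: "\<bar>f y\<bar> \<le> K" for y using K by (auto simp: f_def)
  have intf: "integrable D f"
    using fb by (intro D.integrable_const_bound[where B = K] measurable_D AE_I2) auto
  have intr: "integrable D r"
    unfolding r_def by (intro integrable_abs Bochner_Integration.integrable_diff integrable_D intf)
  define A where "A = (\<lambda>x. \<bar>(\<Sum>j<n. f (x j)) / real n - (\<integral>y. f y \<partial>D)\<bar>)"
  define B where "B = (\<lambda>x. (\<Sum>j<n. r (x j)) / real n)"
  have intA: "integrable (sample n) A"
    unfolding A_def
    by (intro integrable_abs Bochner_Integration.integrable_diff integrable_divide
      Bochner_Integration.integrable_sum sample_integral(1)[OF intf]) auto
  have intB: "integrable (sample n) B"
    unfolding B_def by (intro integrable_divide Bochner_Integration.integrable_sum sample_integral(1)[OF intr]) auto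
  have EB: "(\<integral>x. B x \<partial>sample n) = (\<integral>y. r y \<partial>D)"
  proof -
    have "(\<integral>x. B x \<partial>sample n) = (\<Sum>j<n. (\<integral>x. r (x j) \<partial>sample n)) / real n"
      unfolding B_def using sample_integral(1)[OF intr]
      by (simp add: Bochner_Integration.integral_sum)
    also have "\<dots> = (\<integral>y. r y \<partial>D)"
      using n sample_integral(2)[OF intr] by simp
    finally show ?thesis .
  qed
  have m: "\<bar>(\<integral>y. f y \<partial>D) - \<mu>\<bar> \<le> (\<integral>y. r y \<partial>D)"
  proof -
    have "\<bar>(\<integral>y. f y \<partial>D) - \<mu>\<bar> = \<bar>\<integral>y. f y - y \<partial>D\<bar>"
      using intf integrable_D by simp
    also have "\<dots> \<le> (\<integral>y. \<bar>f y - y\<bar> \<partial>D)" by (rule integral_abs_bound)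
    finally show ?thesis by (simp add: r_def abs_minus_commute)
  qed
  have "(\<integral>x. \<bar>sample_mean n x - \<mu>\<bar> \<partial>sample n) \<le> (\<integral>x. A x + B x + (\<integral>y. r y \<partial>D) \<partial>sample n)"
  proof (intro integral_mono sample_mean_integrable Bochner_Integration.integrable_add intA intB)
    fix x
    have "\<bar>sample_mean n x - (\<Sum>j<n. f (x j)) / real n\<bar> = \<bar>\<Sum>j<n. x j - f (x j)\<bar> / real n"
      by (simp add: sample_mean_def sum_subtractf diff_divide_distrib[symmetric])
    also have "\<dots> \<le> B x"
      unfolding B_def r_def by (intro divide_right_mono sum_abs) auto
    finally show "\<bar>sample_mean n x - \<mu>\<bar> \<le> A x + B x + (\<integral>y. r y \<partial>D)"
      using m unfolding A_def by linarith
  qed simp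
  also have "\<dots> = (\<integral>x. A x \<partial>sample n) + 2 * (\<integral>y. r y \<partial>D)"
    using intA intB EB S.prob_space by simp
  also have "(\<integral>x. A x \<partial>sample n) \<le> K / sqrt (real n)"
    unfolding A_def by (rule sample_average_deviation_le) (use fb n in auto)
  finally show ?thesis by (simp add: r_def f_def)
qed

lemma truncation_error_tendsto_0:
  "(\<lambda>k. \<integral>y. \<bar>y - max (- real k) (min (real k) y)\<bar> \<partial>D) \<longlonglongrightarrow> 0"
proof -
  have "(\<lambda>k. \<integral>y. \<bar>y - max (- real k) (min (real k) y)\<bar> \<partial>D) \<longlonglongrightarrow> (\<integral>y. 0 \<partial>D)"
  proof (rule integral_dominated_convergence[where w = "\<lambda>y. \<bar>y\<bar>"])
    show "AE y in D. (\<lambda>k. \<bar>y - max (- real k) (min (real k) y)\<bar>) \<longlonglongrightarrow> 0"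
    proof (intro AE_I2 tendsto_eventually)
      fix y :: real
      show "\<forall>\<^sub>F k in sequentially. \<bar>y - max (- real k) (min (real k) y)\<bar> = 0"
        using eventually_ge_at_top[of "nat \<lceil>\<bar>y\<bar>\<rceil>"]
        by eventually_elim (simp add: max_def min_def, linarith)
    qed
  next
    show "integrable D (\<lambda>y. \<bar>y\<bar>)" using integrable_D by (rule integrable_abs)
    show "AE y in D. norm \<bar>y - max (- real k) (min (real k) y)\<bar> \<le> \<bar>y\<bar>" for k
      by (intro AE_I2) (simp add: max_def min_def)
  qed (intro measurable_D; measurable)+
  then show ?thesis by simp
qed

lemma sample_mean_L1:
  "(\<lambda>n. \<integral>x. \<bar>sample_mean n x - \<mu>\<bar> \<partial>sample n) \<longlonglongrightarrow> 0"
proof (rule LIMSEQ_I)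
  fix e :: real assume e: "e > 0"
  let ?t = "\<lambda>k. \<integral>y. \<bar>y - max (- real k) (min (real k) y)\<bar> \<partial>D"
  have "\<forall>\<^sub>F k in sequentially. ?t k < e / 4"
    using e by (intro order_tendstoD(2)[OF truncation_error_tendsto_0]) simp
  then obtain k where k: "?t k < e / 4"
    by (auto simp: eventually_sequentially)
  have "(\<lambda>n. real k / sqrt (real n)) \<longlonglongrightarrow> 0"
    by (intro tendsto_divide_0[OF tendsto_const] filterlim_at_top_imp_at_infinity
        filterlim_compose[OF sqrt_at_top filterlim_real_sequentially])
  then have "\<forall>\<^sub>F n in sequentially. real k / sqrt (real n) < e / 2"
    using e by (intro order_tendstoD(2)[of _ 0]) auto
  then have "\<forall>\<^sub>F n in sequentially. norm ((\<integral>x. \<bar>sample_mean n x - \<mu>\<bar> \<partial>sample n) - 0) < e"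
    using eventually_gt_at_top[of 0]
  proof eventually_elim
    case (elim n)
    have "(\<integral>x. \<bar>sample_mean n x - \<mu>\<bar> \<partial>sample n) \<ge> 0" by simp
    then show ?case
      using sample_mean_L1_bound[of "real k" n] elim k
      unfolding real_norm_def diff_0_right by linarith
  qed
  then show "\<exists>no. \<forall>n\<ge>no. norm ((\<integral>x. \<bar>sample_mean n x - \<mu>\<bar> \<partial>sample n) - 0) < e"
    by (simp add: eventually_sequentially)
qed

section \<open>Convergence of the statistic\<close>

lemma hankel_transform_measurable [measurable]: "hankel_transform a D \<in> borel_measurable borel"
  unfolding hankel_transform_def
  by (rule D.borel_measurable_lebesgue_integral) measurable

lemma even_kernel_integrable:
  "integrable D (\<lambda>y. even_kernel a (t * (y / m)))"
  by (rule D.integrable_const_bound[where B = 1])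
    (simp_all add: even_kernel_abs_le_1[OF a_ge] measurable_D)

lemma hankel_transform_abs_le_1: "\<bar>hankel_transform a D t\<bar> \<le> 1"
  unfolding hankel_transform_def
  by (intro order_trans[OF integral_abs_bound] D.integral_le_const integrable_abs
      even_kernel_integrable AE_I2 even_kernel_abs_le_1 a_ge)

lemma empirical_transform_abs_le_1: "\<bar>empirical_transform a n x m t\<bar> \<le> 1"
proof (cases "n = 0")
  case False
  have "\<bar>\<Sum>j<n. even_kernel a (t * (x j / m))\<bar> \<le> (\<Sum>j<n. 1)"
    by (intro order_trans[OF sum_abs] sum_mono even_kernel_abs_le_1[OF a_ge])
  then show ?thesis using False by (simp add: empirical_transform_def)
qed (simp add: empirical_transform_def)

lemma empirical_transform_measurable [measurable]:
  assumes [measurable]: "m \<in> borel_measurable (sample n)"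
  shows "(\<lambda>(x, t). empirical_transform a n x (m x) t) \<in> borel_measurable (sample n \<Otimes>\<^sub>M borel)"
  unfolding empirical_transform_def by measurable

lemma empirical_transform_measurable_snd [measurable]:
  "empirical_transform a n x m \<in> borel_measurable borel"
  unfolding empirical_transform_def[abs_def] by measurable

lemma T2_measurable [measurable]: "T2 a n \<in> borel_measurable (sample n)"
proof -
  have [measurable]: "(\<lambda>x. scaled_obs n x j) \<in> borel_measurable (sample n)" if "j < n" for j
    unfolding scaled_obs_def using that by measurable
  have "(\<lambda>x. LINT t:{0<..}|G. ((\<Sum>j<n. Gamma a * hankel_kernel a (t * scaled_obs n x j)) / real n
          - exp (- t / a))\<^sup>2) \<in> borel_measurable (sample n)"
    unfolding set_lebesgue_integral_def
    by (rule G.borel_measurable_lebesgue_integral) measurable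
  then show ?thesis unfolding T2_def[abs_def] by measurable
qed

lemma mean_nonneg: "\<mu> \<ge> 0"
  using nonneg by (rule integral_nonneg_AE)

text \<open>A nonnegative law with mean zero is concentrated at the origin. The second conjunct records this,
  so that later estimates, read with division by zero giving zero, cover the degenerate law
  too.\<close>

lemma sample_AE_nonneg: "AE x in sample n. \<forall>j<n. x j \<ge> 0 \<and> (\<mu> = 0 \<longrightarrow> x j = 0)"
proof (rule sample_AE)
  show "AE y in D. y \<ge> 0 \<and> (\<mu> = 0 \<longrightarrow> y = 0)"
  proof (cases "\<mu> = 0")
    case True
    then have "AE y in D. y = 0"
      using integral_nonneg_eq_0_iff_AE[OF integrable_D nonneg] by simp
    then show ?thesis by eventually_elim simp
  qed (use nonneg in auto)
qed

text \<open>The price of replacing the sample mean by the true mean as the scale. By the Lipschitz bound it is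
  at most \<open>\<bar>t\<bar> / a\<close> times the average of \<open>\<bar>x j / m - x j / \<mu>\<bar>\<close> with \<open>m\<close> the sample mean, and for
  nonnegative observations and positive means this average equals \<open>m * \<bar>1 / m - 1 / \<mu>\<bar>\<close>.\<close>

lemma empirical_transform_rescale:
  assumes n: "n > 0" and x: "\<forall>j<n. x j \<ge> 0 \<and> (\<mu> = 0 \<longrightarrow> x j = 0)"
  shows "\<bar>empirical_transform a n x (sample_mean n x) t - empirical_transform a n x \<mu> t\<bar>
    \<le> \<bar>t\<bar> / a * (\<bar>sample_mean n x - \<mu>\<bar> / \<mu>)"
proof -
  let ?m = "sample_mean n x"
  have m: "?m \<ge> 0" using x by (auto simp: sample_mean_def intro!: divide_nonneg_nonneg sum_nonneg)
  have sum: "(\<Sum>j<n. x j) = real n * ?m" using n by (simp add: sample_mean_def)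
  have avg: "(\<Sum>j<n. \<bar>x j / ?m - x j / \<mu>\<bar>) / real n \<le> \<bar>?m - \<mu>\<bar> / \<mu>"
  proof (cases "?m = 0 \<or> \<mu> = 0")
    case True
    have "x j = 0" if "j < n" for j
    proof (cases "\<mu> = 0")
      case False
      with True have "(\<Sum>j<n. x j) = 0" using sum by simp
      then show ?thesis using x that by (subst (asm) sum_nonneg_eq_0_iff) auto
    qed (use x that in auto)
    then show ?thesis using mean_nonneg by simp
  next
    case False
    with m mean_nonneg have p: "?m > 0" "\<mu> > 0" by auto
    have "(\<Sum>j<n. \<bar>x j / ?m - x j / \<mu>\<bar>) = (\<Sum>j<n. x j * \<bar>1 / ?m - 1 / \<mu>\<bar>)"
    proof (intro sum.cong refl)
      fix j assume "j \<in> {..<n}"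
      then have "x j \<ge> 0" using x by auto
      moreover have "x j / ?m - x j / \<mu> = x j * (1 / ?m - 1 / \<mu>)" by (simp add: right_diff_distrib)
      ultimately show "\<bar>x j / ?m - x j / \<mu>\<bar> = x j * \<bar>1 / ?m - 1 / \<mu>\<bar>" by (simp add: abs_mult)
    qed
    also have "\<dots> = real n * ?m * \<bar>1 / ?m - 1 / \<mu>\<bar>"
      by (simp only: sum_distrib_right[symmetric] sum)
    also have "1 / ?m - 1 / \<mu> = (\<mu> - ?m) / (?m * \<mu>)"
      using p by (simp add: diff_frac_eq)
    also have "\<bar>(\<mu> - ?m) / (?m * \<mu>)\<bar> = \<bar>?m - \<mu>\<bar> / (?m * \<mu>)"
      using p by (simp add: abs_divide abs_mult abs_minus_commute)
    finally show ?thesis using n p by simp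
  qed
  have "\<bar>empirical_transform a n x ?m t - empirical_transform a n x \<mu> t\<bar>
      = \<bar>\<Sum>j<n. even_kernel a (t * (x j / ?m)) - even_kernel a (t * (x j / \<mu>))\<bar> / real n"
    by (simp add: empirical_transform_def sum_subtractf diff_divide_distrib[symmetric])
  also have "\<dots> \<le> (\<Sum>j<n. \<bar>t\<bar> / a * \<bar>x j / ?m - x j / \<mu>\<bar>) / real n"
  proof (intro divide_right_mono order_trans[OF sum_abs] sum_mono)
    fix j
    have "\<bar>even_kernel a (t * (x j / ?m)) - even_kernel a (t * (x j / \<mu>))\<bar>
        \<le> \<bar>t * (x j / ?m) - t * (x j / \<mu>)\<bar> / a"
      by (rule even_kernel_lipschitz[OF a_ge])
    also have "\<bar>t * (x j / ?m) - t * (x j / \<mu>)\<bar> = \<bar>t\<bar> * \<bar>x j / ?m - x j / \<mu>\<bar>"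
      by (simp only: right_diff_distrib[symmetric] abs_mult)
    finally show "\<bar>even_kernel a (t * (x j / ?m)) - even_kernel a (t * (x j / \<mu>))\<bar>
        \<le> \<bar>t\<bar> / a * \<bar>x j / ?m - x j / \<mu>\<bar>" by simp
  qed simp
  also have "\<dots> = \<bar>t\<bar> / a * ((\<Sum>j<n. \<bar>x j / ?m - x j / \<mu>\<bar>) / real n)"
    unfolding sum_distrib_left[symmetric] by simp
  also have "\<dots> \<le> \<bar>t\<bar> / a * (\<bar>?m - \<mu>\<bar> / \<mu>)"
    using a_pos by (intro mult_left_mono[OF avg]) simp
  finally show ?thesis .
qed

definition transform_error :: "nat \<Rightarrow> (nat \<Rightarrow> real) \<Rightarrow> real" where
  "transform_error n x = (\<integral>t. \<bar>empirical_transform a n x \<mu> t - hankel_transform a D t\<bar> \<partial>G)"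

text \<open>By Fubini's theorem the expectation may be taken inside the integral over \<open>t\<close>, where the bound
  for averages of bounded observables holds uniformly in \<open>t\<close>.\<close>

lemma transform_error_integrable: "integrable (sample n) (transform_error n)"
  and transform_error_integral_le:
    "n > 0 \<Longrightarrow> (\<integral>x. transform_error n x \<partial>sample n) \<le> 1 / sqrt (real n)"
proof -
  interpret pair: pair_prob_space "sample n" G ..
  let ?h = "\<lambda>x t. \<bar>empirical_transform a n x \<mu> t - hankel_transform a D t\<bar>"
  have hb: "?h x t \<le> 2" for x t
    using empirical_transform_abs_le_1[of n x \<mu> t] hankel_transform_abs_le_1[of t] by linarith
  have hm: "(\<lambda>(x, t). ?h x t) \<in> borel_measurable (sample n \<Otimes>\<^sub>M G)"
    by measurable
  have int: "integrable (sample n \<Otimes>\<^sub>M G) (\<lambda>(x, t). ?h x t)"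
    by (rule pair.integrable_const_bound[where B = 2, OF _ hm]) (auto simp: hb)
  show "integrable (sample n) (transform_error n)"
    unfolding transform_error_def[abs_def] using pair.integrable_fst'[OF int] by simp
  assume n: "n > 0"
  have "(\<integral>x. transform_error n x \<partial>sample n) = (\<integral>t. (\<integral>x. ?h x t \<partial>sample n) \<partial>G)"
    unfolding transform_error_def by (rule pair.Fubini_integral[OF int, symmetric])
  also have "\<dots> \<le> 1 / sqrt (real n)"
  proof (rule G.integral_le_const)
    show "integrable G (\<lambda>t. \<integral>x. ?h x t \<partial>sample n)"
      using pair.integrable_snd[OF int] by simp
    show "AE t in G. (\<integral>x. ?h x t \<partial>sample n) \<le> 1 / sqrt (real n)"
    proof (intro AE_I2)
      fix t
      show "(\<integral>x. ?h x t \<partial>sample n) \<le> 1 / sqrt (real n)"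
        unfolding empirical_transform_def hankel_transform_def
        by (rule sample_average_deviation_le[OF _ _ n]) (auto intro: even_kernel_abs_le_1 a_ge)
    qed
  qed
  finally show "(\<integral>x. transform_error n x \<partial>sample n) \<le> 1 / sqrt (real n)" .
qed

text \<open>The integrands of \<open>T2 / n\<close> and of the discrepancy are squares of quantities bounded by \<open>2\<close>, so
  their difference is at most \<open>4\<close> times the difference of the transforms. Splitting the latter at the
  transform scaled by the true mean gives the two terms; the second carries no further constant since
  the mean of \<open>\<bar>t\<bar>\<close> under \<open>gamma_dist a 1\<close> is \<open>a\<close>.\<close>

lemma T2_deviation_le:
  assumes n: "n > 0" and x: "\<forall>j<n. x j \<ge> 0 \<and> (\<mu> = 0 \<longrightarrow> x j = 0)"
  shows "\<bar>T2 a n x / real n - discrepancy a D\<bar>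
    \<le> 4 * transform_error n x + 4 * (\<bar>sample_mean n x - \<mu>\<bar> / \<mu>)"
proof -
  let ?U = "empirical_transform a n x (sample_mean n x)" and ?W = "empirical_transform a n x \<mu>"
  let ?\<phi> = "hankel_transform a D" and ?e = "\<lambda>t. exp (- \<bar>t\<bar> / a)"
  let ?d = "\<bar>sample_mean n x - \<mu>\<bar> / \<mu>"
  have e: "\<bar>?e t\<bar> \<le> 1" for t using a_pos by simp
  have bU: "\<bar>?U t - ?e t\<bar> \<le> 2" for t
    using empirical_transform_abs_le_1[of n x "sample_mean n x" t] e[of t] by linarith
  have b\<phi>: "\<bar>?\<phi> t - ?e t\<bar> \<le> 2" for t
    using hankel_transform_abs_le_1[of t] e[of t] by linarith
  have iU: "integrable G (\<lambda>t. (?U t - ?e t)\<^sup>2)"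
    by (rule integrable_square_of_bounded[OF G.prob_space_axioms _ bU]) measurable
  have i\<phi>: "integrable G (\<lambda>t. (?\<phi> t - ?e t)\<^sup>2)"
    by (rule integrable_square_of_bounded[OF G.prob_space_axioms _ b\<phi>]) measurable
  have iW: "integrable G (\<lambda>t. \<bar>?W t - ?\<phi> t\<bar>)"
  proof (rule G.integrable_const_bound[where B = 2])
    show "AE t in G. norm \<bar>?W t - ?\<phi> t\<bar> \<le> 2"
      unfolding real_norm_def abs_idempotent
    proof (intro AE_I2)
      fix t show "\<bar>?W t - ?\<phi> t\<bar> \<le> 2"
        using empirical_transform_abs_le_1[of n x \<mu> t] hankel_transform_abs_le_1[of t] by linarith
    qed
  qed measurable
  have mom: "has_bochner_integral G (\<lambda>t. \<bar>t\<bar>) a"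
  proof -
    have 1: "has_bochner_integral G (\<lambda>t. t) a"
      using has_bochner_integral_gamma_dist_power[OF a_pos zero_less_one, of 1] by simp
    have "(\<integral>t. \<bar>t\<bar> \<partial>G) = (\<integral>t. t \<partial>G)"
    proof (rule integral_cong_AE)
      show "AE t in G. \<bar>t\<bar> = t"
        using AE_gamma_dist_pos by eventually_elim simp
    qed measurable
    with 1 show ?thesis by (simp add: has_bochner_integral_iff)
  qed
  then have it: "integrable G (\<lambda>t. \<bar>t\<bar>)" by (simp add: has_bochner_integral_iff)
  have diff: "T2 a n x / real n - discrepancy a D = (\<integral>t. (?U t - ?e t)\<^sup>2 - (?\<phi> t - ?e t)\<^sup>2 \<partial>G)"
    using n x iU i\<phi> by (subst T2_eq[OF a_ge]) (auto simp: discrepancy_def)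
  have "\<bar>T2 a n x / real n - discrepancy a D\<bar> \<le> (\<integral>t. \<bar>(?U t - ?e t)\<^sup>2 - (?\<phi> t - ?e t)\<^sup>2\<bar> \<partial>G)"
    unfolding diff by (rule integral_abs_bound)
  also have "\<dots> \<le> (\<integral>t. 4 * \<bar>?W t - ?\<phi> t\<bar> + (4 / a * ?d) * \<bar>t\<bar> \<partial>G)"
  proof (rule integral_mono)
    show "integrable G (\<lambda>t. \<bar>(?U t - ?e t)\<^sup>2 - (?\<phi> t - ?e t)\<^sup>2\<bar>)"
      by (rule integrable_abs[OF Bochner_Integration.integrable_diff[OF iU i\<phi>]])
    show "integrable G (\<lambda>t. 4 * \<bar>?W t - ?\<phi> t\<bar> + (4 / a * ?d) * \<bar>t\<bar>)"
      by (rule Bochner_Integration.integrable_add[OF integrable_mult_right[OF iW] integrable_mult_right[OF it]])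
    fix t
    have "\<bar>(?U t - ?e t)\<^sup>2 - (?\<phi> t - ?e t)\<^sup>2\<bar> \<le> 4 * \<bar>?U t - ?\<phi> t\<bar>"
      using abs_diff_squares_le[OF bU[of t] b\<phi>[of t]] by simp
    also have "\<dots> \<le> 4 * (\<bar>?W t - ?\<phi> t\<bar> + \<bar>t\<bar> / a * ?d)"
    proof (rule mult_left_mono)
      have "\<bar>?U t - ?\<phi> t\<bar> \<le> \<bar>?W t - ?\<phi> t\<bar> + \<bar>?U t - ?W t\<bar>" by linarith
      also have "\<dots> \<le> \<bar>?W t - ?\<phi> t\<bar> + \<bar>t\<bar> / a * ?d"
        by (intro add_left_mono empirical_transform_rescale[OF n x])
      finally show "\<bar>?U t - ?\<phi> t\<bar> \<le> \<bar>?W t - ?\<phi> t\<bar> + \<bar>t\<bar> / a * ?d" .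
    qed simp
    also have "\<dots> = 4 * \<bar>?W t - ?\<phi> t\<bar> + (4 / a * ?d) * \<bar>t\<bar>"
      by (simp only: distrib_left times_divide_eq_right times_divide_eq_left mult.assoc mult.commute mult.left_commute)
    finally show "\<bar>(?U t - ?e t)\<^sup>2 - (?\<phi> t - ?e t)\<^sup>2\<bar> \<le> 4 * \<bar>?W t - ?\<phi> t\<bar> + (4 / a * ?d) * \<bar>t\<bar>" .
  qed
  also have "\<dots> = 4 * transform_error n x + (4 / a * ?d) * (\<integral>t. \<bar>t\<bar> \<partial>G)"
    unfolding transform_error_def
    by (subst Bochner_Integration.integral_add[OF integrable_mult_right[OF iW] integrable_mult_right[OF it]])
      (simp only: integral_mult_right_zero)
  also have "\<dots> = 4 * transform_error n x + 4 * ?d"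
    using mom a_pos by (simp add: has_bochner_integral_iff)
  finally show ?thesis .
qed

lemma T2_deviation_integral_le:
  assumes n: "n > 0"
  shows "integrable (sample n) (\<lambda>x. \<bar>T2 a n x / real n - discrepancy a D\<bar>)"
    and "(\<integral>x. \<bar>T2 a n x / real n - discrepancy a D\<bar> \<partial>sample n)
      \<le> 4 * (1 / sqrt (real n)) + 4 / \<mu> * (\<integral>x. \<bar>sample_mean n x - \<mu>\<bar> \<partial>sample n)"
proof -
  let ?R = "\<lambda>x. 4 * transform_error n x + 4 / \<mu> * \<bar>sample_mean n x - \<mu>\<bar>"
  have iR: "integrable (sample n) ?R"
    by (intro Bochner_Integration.integrable_add integrable_mult_right
        transform_error_integrable sample_mean_integrable)
  have le: "AE x in sample n. \<bar>T2 a n x / real n - discrepancy a D\<bar> \<le> ?R x"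
    using sample_AE_nonneg by eventually_elim (use T2_deviation_le[OF n] in simp)
  show iL: "integrable (sample n) (\<lambda>x. \<bar>T2 a n x / real n - discrepancy a D\<bar>)"
  proof (rule Bochner_Integration.integrable_bound[OF iR])
    show "AE x in sample n. norm \<bar>T2 a n x / real n - discrepancy a D\<bar> \<le> norm (?R x)"
      using le by eventually_elim (unfold real_norm_def abs_idempotent, linarith)
  qed measurable
  have "(\<integral>x. \<bar>T2 a n x / real n - discrepancy a D\<bar> \<partial>sample n) \<le> (\<integral>x. ?R x \<partial>sample n)"
    by (rule integral_mono_AE[OF iL iR le])
  also have "\<dots> = 4 * (\<integral>x. transform_error n x \<partial>sample n) + 4 / \<mu> * (\<integral>x. \<bar>sample_mean n x - \<mu>\<bar> \<partial>sample n)"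
    by (subst Bochner_Integration.integral_add)
      (simp_all add: transform_error_integrable sample_mean_integrable)
  also have "\<dots> \<le> 4 * (1 / sqrt (real n)) + 4 / \<mu> * (\<integral>x. \<bar>sample_mean n x - \<mu>\<bar> \<partial>sample n)"
    using transform_error_integral_le[OF n] by simp
  finally show "(\<integral>x. \<bar>T2 a n x / real n - discrepancy a D\<bar> \<partial>sample n)
      \<le> 4 * (1 / sqrt (real n)) + 4 / \<mu> * (\<integral>x. \<bar>sample_mean n x - \<mu>\<bar> \<partial>sample n)" .
qed

lemma T2_converges_in_probability:
  assumes \<epsilon>: "\<epsilon> > 0"
  shows "(\<lambda>n. measure (sample n) {x \<in> space (sample n). \<bar>T2 a n x / real n - discrepancy a D\<bar> \<ge> \<epsilon>})
    \<longlonglongrightarrow> 0"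
proof (rule tendsto_sandwich[where f = "\<lambda>_. 0"])
  let ?b = "\<lambda>n. (4 * (1 / sqrt (real n)) + 4 / \<mu> * (\<integral>x. \<bar>sample_mean n x - \<mu>\<bar> \<partial>sample n)) / \<epsilon>"
  have "(\<lambda>n. 1 / sqrt (real n)) \<longlonglongrightarrow> 0"
    by (intro tendsto_divide_0[OF tendsto_const] filterlim_at_top_imp_at_infinity
        filterlim_compose[OF sqrt_at_top filterlim_real_sequentially])
  then have "?b \<longlonglongrightarrow> (4 * 0 + 4 / \<mu> * 0) / \<epsilon>"
    using \<epsilon> by (intro tendsto_intros sample_mean_L1) auto
  then show "?b \<longlonglongrightarrow> 0" by simp
  show "\<forall>\<^sub>F n in sequentially.
      measure (sample n) {x \<in> space (sample n). \<bar>T2 a n x / real n - discrepancy a D\<bar> \<ge> \<epsilon>} \<le> ?b n"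
    using eventually_gt_at_top[of 0]
  proof eventually_elim
    case (elim n)
    have "measure (sample n) {x \<in> space (sample n). \<bar>T2 a n x / real n - discrepancy a D\<bar> \<ge> \<epsilon>}
        \<le> (\<integral>x. \<bar>T2 a n x / real n - discrepancy a D\<bar> \<partial>sample n) / \<epsilon>"
      using \<epsilon> by (intro integral_Markov_inequality_measure[where A = "{}"] T2_deviation_integral_le(1) elim) auto
    also have "\<dots> \<le> ?b n"
      using \<epsilon> by (intro divide_right_mono T2_deviation_integral_le(2) elim) auto
    finally show ?case .
  qed
qed auto

text \<open>Averaging the Hankel transform over a Gamma-distributed \<open>t\<close> and exchanging the integrals yields the
  Laplace transform at the point \<open>1 / (\<mu> * s)\<close>. Hence the Hankel transform and
  the mean determine the law.\<close>

lemma laplace_eq_hankel_integral: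
  assumes \<mu>: "\<mu> > 0" and s: "s > 0"
  shows "(\<integral>x. exp (- x / (\<mu> * s)) \<partial>D) = (\<integral>t. hankel_transform a D t \<partial>gamma_dist a s)"
proof -
  interpret Gs: prob_space "gamma_dist a s" by (rule prob_space_gamma_dist[OF a_pos s])
  interpret pair: pair_prob_space D "gamma_dist a s" ..
  have m: "(\<lambda>(x, t). even_kernel a (t * (x / \<mu>))) \<in> borel_measurable (D \<Otimes>\<^sub>M gamma_dist a s)"
    by measurable
  have int: "integrable (D \<Otimes>\<^sub>M gamma_dist a s) (\<lambda>(x, t). even_kernel a (t * (x / \<mu>)))"
    by (rule pair.integrable_const_bound[where B = 1, OF _ m])
      (auto intro!: even_kernel_abs_le_1[OF a_ge])
  have "(\<integral>t. hankel_transform a D t \<partial>gamma_dist a s)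
      = (\<integral>x. (\<integral>t. even_kernel a (t * (x / \<mu>)) \<partial>gamma_dist a s) \<partial>D)"
    unfolding hankel_transform_def by (rule pair.Fubini_integral[OF int])
  also have "\<dots> = (\<integral>x. exp (- x / (\<mu> * s)) \<partial>D)"
  proof (rule integral_cong_AE)
    show "AE x in D. (\<integral>t. even_kernel a (t * (x / \<mu>)) \<partial>gamma_dist a s) = exp (- x / (\<mu> * s))"
      using nonneg
    proof eventually_elim
      case (elim x)
      have "(\<integral>t. even_kernel a (t * (x / \<mu>)) \<partial>gamma_dist a s)
          = (\<integral>t. norm_bessel a (t * (x / \<mu>)) \<partial>gamma_dist a s)"
      proof (rule integral_cong_AE)
        show "AE t in gamma_dist a s. even_kernel a (t * (x / \<mu>)) = norm_bessel a (t * (x / \<mu>))"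
          using AE_gamma_dist_pos by eventually_elim (use elim \<mu> in \<open>simp add: even_kernel_def\<close>)
        note [measurable] = borel_measurable_norm_bessel[OF a_pos]
        show "(\<lambda>t. norm_bessel a (t * (x / \<mu>))) \<in> borel_measurable (gamma_dist a s)" by measurable
      qed measurable
      also have "\<dots> = exp (- (x / \<mu>) / s)"
        by (rule gamma_dist_integral_norm_bessel[OF a_pos s])
      finally show ?case by simp
    qed
    show "(\<lambda>x. \<integral>t. even_kernel a (t * (x / \<mu>)) \<partial>gamma_dist a s) \<in> borel_measurable D"
      by (rule Gs.borel_measurable_lebesgue_integral[OF m])
  qed measurable
  finally show ?thesis by simp
qed

end

section \<open>The discrepancy characterises the Gamma laws\<close>

lemma nonneg_law_gamma_dist:
  assumes a: "a \<ge> 1 / 2" and b: "b > 0"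
  shows "nonneg_law (gamma_dist a b) a" and "(\<integral>x. x \<partial>gamma_dist a b) = a / b"
proof -
  have a0: "a > 0" using a by simp
  have m: "has_bochner_integral (gamma_dist a b) (\<lambda>x. x) (a / b)"
    using has_bochner_integral_gamma_dist_power[OF a0 b, of 1] by simp
  then show "(\<integral>x. x \<partial>gamma_dist a b) = a / b" by (simp add: has_bochner_integral_iff)
  interpret prob_space "gamma_dist a b" by (rule prob_space_gamma_dist[OF a0 b])
  show "nonneg_law (gamma_dist a b) a"
  proof unfold_locales
    show "AE x in gamma_dist a b. x \<ge> 0"
      using AE_gamma_dist_pos by eventually_elim simp
  qed (use a m in \<open>auto simp: has_bochner_integral_iff\<close>)
qed

lemma hankel_transform_gamma_dist:
  assumes a: "a \<ge> 1 / 2" and b: "b > 0"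
  shows "hankel_transform a (gamma_dist a b) t = exp (- \<bar>t\<bar> / a)"
proof -
  have a0: "a > 0" using a by simp
  note [measurable] = borel_measurable_even_kernel[OF a0] borel_measurable_norm_bessel[OF a0]
  have "hankel_transform a (gamma_dist a b) t = (\<integral>x. norm_bessel a (x * (\<bar>t\<bar> * b / a)) \<partial>gamma_dist a b)"
    unfolding hankel_transform_def nonneg_law_gamma_dist(2)[OF a b]
  proof (rule integral_cong_AE)
    show "AE x in gamma_dist a b. even_kernel a (t * (x / (a / b))) = norm_bessel a (x * (\<bar>t\<bar> * b / a))"
      using AE_gamma_dist_pos
      by eventually_elim (use a0 b in \<open>simp add: even_kernel_def abs_mult mult_ac\<close>)
  qed measurable
  also have "\<dots> = exp (- (\<bar>t\<bar> * b / a) / b)"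
    by (rule gamma_dist_integral_norm_bessel[OF a0 b])
  also have "\<dots> = exp (- \<bar>t\<bar> / a)" using b by simp
  finally show ?thesis .
qed

lemma discrepancy_gamma_dist: "a \<ge> 1 / 2 \<Longrightarrow> b > 0 \<Longrightarrow> discrepancy a (gamma_dist a b) = 0"
  by (simp add: discrepancy_def hankel_transform_gamma_dist)

context nonneg_law
begin

text \<open>If the discrepancy vanishes, the Hankel transform agrees almost everywhere with the
  exponential, that is, with the transform of the Gamma law with the same mean. The degenerate law has
  transform constantly \<open>1\<close> and is excluded; otherwise both laws have the same Laplace transform at all
  positive integers.\<close>

lemma discrepancy_eq_0_imp_gamma:
  assumes 0: "discrepancy a D = 0"
  shows "\<mu> > 0" and "D = gamma_dist a (a / \<mu>)"
proof -
  let ?\<phi> = "hankel_transform a D" and ?e = "\<lambda>t. exp (- \<bar>t\<bar> / a)"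
  have b: "\<bar>?\<phi> t - ?e t\<bar> \<le> 2" for t
  proof -
    have "\<bar>?e t\<bar> \<le> 1" using a_pos by simp
    then show ?thesis using hankel_transform_abs_le_1[of t] by linarith
  qed
  have i: "integrable G (\<lambda>t. (?\<phi> t - ?e t)\<^sup>2)"
    by (rule integrable_square_of_bounded[OF G.prob_space_axioms _ b]) measurable
  have "AE t in G. (?\<phi> t - ?e t)\<^sup>2 = 0"
    using 0 integral_nonneg_eq_0_iff_AE[OF i] by (simp add: discrepancy_def)
  then have eq: "AE t in G. ?\<phi> t = ?e t" by eventually_elim simp
  show \<mu>: "\<mu> > 0"
  proof (rule ccontr)
    assume "\<not> \<mu> > 0"
    with mean_nonneg have "\<mu> = 0" by simp
    then have "?\<phi> t = 1" for t
      by (simp add: hankel_transform_def even_kernel_def D.prob_space)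
    with eq have "AE t in G. ?e t = 1" by simp
    then have "AE t in G. False"
      using AE_gamma_dist_pos by eventually_elim (use a_pos in simp)
    then show False by simp
  qed
  let ?N = "gamma_dist a (a / \<mu>)"
  have r: "a / \<mu> > 0" using a_pos \<mu> by simp
  interpret N: nonneg_law ?N a by (rule nonneg_law_gamma_dist[OF a_ge r])
  have N\<mu>: "(\<integral>x. x \<partial>?N) = \<mu>"
    using nonneg_law_gamma_dist(2)[OF a_ge r] a_pos by simp
  show "D = ?N"
  proof (rule laplace_uniqueness_nat)
    fix k :: nat assume k: "k > 0"
    \<comment> \<open>The rate for which \<open>laplace_eq_hankel_integral\<close> evaluates the Laplace transform at \<open>k\<close>.\<close>
    let ?s = "1 / (real k * \<mu>)"
    have s: "?s > 0" using k \<mu> by simp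
    have ks: "- real k * x = - x / (\<mu> * ?s)" for x using k \<mu> by simp
    have "AE t in gamma_dist a ?s. ?\<phi> t = ?e t"
      by (rule AE_gamma_dist_change_rate[OF a_pos eq zero_less_one s]) measurable
    then have "(\<integral>t. ?\<phi> t \<partial>gamma_dist a ?s) = (\<integral>t. hankel_transform a ?N t \<partial>gamma_dist a ?s)"
      unfolding hankel_transform_gamma_dist[OF a_ge r] by (intro integral_cong_AE) measurable
    then show "(\<integral>x. exp (- real k * x) \<partial>D) = (\<integral>x. exp (- real k * x) \<partial>?N)"
      using laplace_eq_hankel_integral[OF \<mu> s] N.laplace_eq_hankel_integral[unfolded N\<mu>, OF \<mu> s]
      unfolding ks by simp
  qed (rule D.prob_space_axioms sets_D nonneg N.D.prob_space_axioms N.sets_D N.nonneg)+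
qed

end

section \<open>Consistency of the test\<close>

text \<open>Under the null hypothesis \<open>T2 / n\<close> tends to zero in probability, as the discrepancy of a Gamma law
  is zero. So \<open>n * \<epsilon>\<close> is eventually exceeded with probability at most \<open>\<gamma>\<close>.\<close>

lemma critical_value_le:
  assumes a: "a \<ge> 1 / 2" and b: "b > 0" and \<gamma>: "\<gamma> > 0" and \<epsilon>: "\<epsilon> > 0"
  shows "\<forall>\<^sub>F n in sequentially. critical_value a b n \<gamma> \<le> real n * \<epsilon>"
proof -
  interpret N: nonneg_law "gamma_dist a b" a by (rule nonneg_law_gamma_dist[OF a b])
  let ?S = "\<lambda>n. \<Pi>\<^sub>M j\<in>{..<n}. gamma_dist a b"
  have "\<forall>\<^sub>F n in sequentially. measure (?S n) {x \<in> space (?S n). \<bar>T2 a n x / real n\<bar> \<ge> \<epsilon>} < \<gamma>"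
    using N.T2_converges_in_probability[OF \<epsilon>] \<gamma>
    by (intro order_tendstoD(2)[of _ 0]) (simp_all add: discrepancy_gamma_dist[OF a b])
  then show ?thesis
    using eventually_gt_at_top[of 0]
  proof eventually_elim
    case (elim n)
    have "measure (?S n) {x \<in> space (?S n). T2 a n x > real n * \<epsilon>}
        \<le> measure (?S n) {x \<in> space (?S n). \<bar>T2 a n x / real n\<bar> \<ge> \<epsilon>}"
    proof (rule N.S.finite_measure_mono)
      show "{x \<in> space (?S n). T2 a n x > real n * \<epsilon>} \<subseteq> {x \<in> space (?S n). \<bar>T2 a n x / real n\<bar> \<ge> \<epsilon>}"
      proof safe
        fix x assume "T2 a n x > real n * \<epsilon>"
        then have "T2 a n x / real n \<ge> \<epsilon>" using elim by (simp add: field_simps)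
        then show "\<bar>T2 a n x / real n\<bar> \<ge> \<epsilon>" by linarith
      qed
    qed measurable
    also have "\<dots> \<le> \<gamma>" using elim by simp
    finally show ?case
      unfolding critical_value_def using \<epsilon>
      by (intro cInf_lower bdd_belowI[of _ 0]) auto
  qed
qed

lemma T2_cong:
  assumes "\<And>j. j < n \<Longrightarrow> x j = y j"
  shows "T2 a n x = T2 a n y"
proof -
  have "sample_mean n x = sample_mean n y"
    unfolding sample_mean_def using assms by simp
  then have "scaled_obs n x j = scaled_obs n y j" if "j < n" for j
    unfolding scaled_obs_def using assms that by simp
  then show ?thesis unfolding T2_def by simp
qed

lemma iid_sample_distr:
  assumes M: "prob_space M" and indep: "prob_space.indep_vars M (\<lambda>_. borel) X UNIV"
    and ident: "\<And>j. distr M borel (X j) = D" and n: "n > 0"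
  shows "distr M (\<Pi>\<^sub>M j\<in>{..<n::nat}. borel) (\<lambda>\<omega>. \<lambda>j\<in>{..<n}. X j \<omega>) = (\<Pi>\<^sub>M j\<in>{..<n}. D)"
proof -
  interpret prob_space M by fact
  have rv: "X j \<in> borel_measurable M" for j
    using indep by (simp add: indep_vars_def)
  have "indep_vars (\<lambda>_. borel) X {..<n}"
    by (rule indep_vars_subset[OF indep]) simp
  then show ?thesis
    using indep_vars_iff_distr_eq_PiM[where I = "{..<n}" and M' = "\<lambda>_. borel" and X = X] rv n ident by auto
qed

theorem theorem3p16:
  fixes M :: "'a measure" and X :: "nat \<Rightarrow> 'a \<Rightarrow> real" and \<alpha> \<mu> \<gamma> \<beta>\<^sub>0 :: real
  assumes "prob_space M"
    and "\<alpha> \<ge> 1 / 2"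
    and "prob_space.indep_vars M (\<lambda>_. borel) X UNIV"
    and "\<And>j. distr M borel (X j) = distr M borel (X 0)"
    and "\<And>j. AE \<omega> in M. X j \<omega> \<ge> 0"
    and "has_bochner_integral M (X 0) \<mu>"
    and "0 < \<gamma>" and "\<gamma> < 1"
    and "\<beta>\<^sub>0 > 0"
    and "\<And>\<beta>. \<beta> > 0 \<Longrightarrow> distr M borel (X 0) \<noteq> gamma_dist \<alpha> \<beta>"
  shows "(\<lambda>n. measure M {\<omega> \<in> space M. T2 \<alpha> n (\<lambda>j. X j \<omega>) > critical_value \<alpha> \<beta>\<^sub>0 n \<gamma>})
           \<longlonglongrightarrow> 1"
proof -
  interpret prob_space M by fact
  have rv [measurable]: "X j \<in> borel_measurable M" for j
    using assms(3) by (simp add: indep_vars_def)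
  define D where "D = distr M borel (X 0)"
  have "nonneg_law D \<alpha>"
  proof (rule nonneg_law.intro)
    show "prob_space D" unfolding D_def by (rule prob_space_distr) (rule rv)
    show "nonneg_law_axioms D \<alpha>"
    proof
      show "AE x in D. x \<ge> 0"
        unfolding D_def using assms(5)[of 0] by (subst AE_distr_iff) auto
      show "integrable D (\<lambda>x. x)"
        unfolding D_def using assms(6) by (subst integrable_distr_eq) (auto simp: has_bochner_integral_iff)
    qed (use assms(2) in \<open>auto simp: D_def\<close>)
  qed
  then interpret D: nonneg_law D \<alpha> .
  let ?S = "\<lambda>n. \<Pi>\<^sub>M j\<in>{..<n}. D"
  define \<Delta> where "\<Delta> = discrepancy \<alpha> D"
  have "\<Delta> \<noteq> 0"
    using D.discrepancy_eq_0_imp_gamma assms(10) D.a_pos unfolding \<Delta>_def D_def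
    by (metis divide_pos_pos)
  moreover have "\<Delta> \<ge> 0" unfolding \<Delta>_def discrepancy_def by simp
  ultimately have \<Delta>: "\<Delta> > 0" by simp
  let ?p = "\<lambda>n. measure M {\<omega> \<in> space M. T2 \<alpha> n (\<lambda>j. X j \<omega>) > critical_value \<alpha> \<beta>\<^sub>0 n \<gamma>}"
  let ?q = "\<lambda>n. measure (?S n) {x \<in> space (?S n). \<bar>T2 \<alpha> n x / real n - \<Delta>\<bar> \<ge> \<Delta> / 2}"
  show ?thesis
  proof (rule tendsto_sandwich)
    have "?q \<longlonglongrightarrow> 0"
      unfolding \<Delta>_def by (rule D.T2_converges_in_probability) (use \<Delta> in \<open>simp add: \<Delta>_def\<close>)
    then have "(\<lambda>n. 1 - ?q n) \<longlonglongrightarrow> 1 - 0" by (intro tendsto_intros)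
    then show "(\<lambda>n. 1 - ?q n) \<longlonglongrightarrow> 1" by simp
    have "\<forall>\<^sub>F n in sequentially. critical_value \<alpha> \<beta>\<^sub>0 n \<gamma> \<le> real n * (\<Delta> / 2)"
      using \<Delta> by (intro critical_value_le assms) auto
    then show "\<forall>\<^sub>F n in sequentially. 1 - ?q n \<le> ?p n"
      using eventually_gt_at_top[of 0]
    proof eventually_elim
      case (elim n)
      let ?c = "critical_value \<alpha> \<beta>\<^sub>0 n \<gamma>"
      let ?V = "\<lambda>\<omega>. \<lambda>j\<in>{..<n}. X j \<omega>"
      have V: "?V \<in> M \<rightarrow>\<^sub>M (\<Pi>\<^sub>M j\<in>{..<n}. borel)" by measurable
      have S: "?S n = distr M (\<Pi>\<^sub>M j\<in>{..<n}. borel) ?V"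
        using iid_sample_distr[OF assms(1,3) _ elim(2), of D] assms(4) D_def by simp
      have T: "T2 \<alpha> n (\<lambda>j. X j \<omega>) = T2 \<alpha> n (?V \<omega>)" for \<omega> by (rule T2_cong) simp
      have m: "{x \<in> space (?S n). T2 \<alpha> n x > ?c} \<in> sets (?S n)" by measurable
      have "?p n = measure (?S n) {x \<in> space (?S n). T2 \<alpha> n x > ?c}"
        using m measurable_space[OF V] unfolding T S
        by (subst measure_distr[OF V]) (auto intro!: arg_cong[where f = "measure M"])
      moreover have "1 - ?q n = measure (?S n) (space (?S n) - {x \<in> space (?S n). \<bar>T2 \<alpha> n x / real n - \<Delta>\<bar> \<ge> \<Delta> / 2})"
        by (rule D.S.prob_compl[symmetric]) measurable
      moreover have "\<dots> \<le> measure (?S n) {x \<in> space (?S n). T2 \<alpha> n x > ?c}"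
      proof (rule D.S.finite_measure_mono[OF _ m], safe)
        fix x assume "\<not> \<bar>T2 \<alpha> n x / real n - \<Delta>\<bar> \<ge> \<Delta> / 2"
        then have "T2 \<alpha> n x / real n > \<Delta> / 2" by linarith
        then have "T2 \<alpha> n x > real n * (\<Delta> / 2)" using elim(2) by (simp add: field_simps)
        then show "T2 \<alpha> n x > ?c" using elim(1) by linarith
      qed
      ultimately show ?case by simp
    qed
  qed auto
qed

end
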